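(* Let $N$ be a finite ground set and let $\mathbb{G}_N$ be the set of all gaussoids over $N$. (a) For every field $\mathbb{K}$ of characteristic zero, $\mathbb{G}_N$ is a two-antecedental approximation of the set of CI structures over $N$ which are algebraically realizable over $\mathbb{K}$. (b) For every ordered field $\mathbb{K}$, $\mathbb{G}_N$ is a two-antecedental approximation of the set of CI structures over $N$ which are positively realizable over $\mathbb{K}$. That is: every inference form $\bigwedge \mathcal{L} \Rightarrow \bigvee \mathcal{M}$ with $\mathcal{L}, \mathcal{M} \subseteq \mathcal{A}_N$ and $|\mathcal{L}| \le 2$ which is valid for all algebraically realizable CI structures over $\mathbb{K}$ (respectively, for all positively realizable CI structures over $\mathbb{K}$) is valid for all gaussoids over $N$.
   Context: Elements $i \in N$ are identified with singletons and juxtaposition denotes union of subsets of $N$. The set of conditional independence (CI) statements over $N$ is $\mathcal{A}_N = \{(ij|K) : i,j \in N \text{ distinct}, K \subseteq N \setminus ij\}$, where $(ij|K) = (ji|K)$. A CI structure over $N$ is a subset of $\mathcal{A}_N$. A gaussoid over $N$ is a subset of $\mathcal{A}_N$ which satisfies, for all distinct $i,j,k \in N$ and $L \subseteq N \setminus ijk$ (truth of a CI statement meaning membership in the set): (i) $(ij|L) \wedge (ik|jL) \Leftrightarrow (ik|L) \wedge (ij|kL)$; (ii) $(ij|kL) \wedge (ik|jL) \Leftrightarrow (ij|L) \wedge (ik|L)$; (iii) $(ij|L) \wedge (ij|kL) \Rightarrow (ik|L) \vee (jk|L)$. A symmetric matrix $\Gamma \in \mathbb{K}^{N \times N}$ over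 a field $\mathbb{K}$ is principally regular if all its principal minors $\det \Gamma_{K,K}$, $K \subseteq N$, are non-zero. Put $[\![\Gamma]\!] = \{(ij|K) \in \mathcal{A}_N : \det \Gamma_{iK,jK} = 0\}$, where $\Gamma_{iK,jK}$ is the submatrix with rows $iK$ and columns $jK$. A CI structure is algebraically realizable over $\mathbb{K}$ if it equals $[\![\Gamma]\!]$ for some principally regular $\Gamma$ over $\mathbb{K}$; if $\mathbb{K}$ is an ordered field, it is positively realizable over $\mathbb{K}$ if it equals $[\![\Gamma]\!]$ for some symmetric $\Gamma$ over $\mathbb{K}$ all of whose principal minors are positive. It is known that all algebraically realizable CI structures are gaussoids. An inference form is a formula $\bigwedge \mathcal{L} \Rightarrow \bigvee \mathcal{M}$ with $\mathcal{L}, \mathcal{M} \subseteq \mathcal{A}_N$; a CI structure $\mathcal{A}$ satisfies it if $\mathcal{L} \subseteq \mathcal{A}$ implies $\mathcal{A} \cap \mathcal{M} \neq \emptyset$. It is valid for a set of CI structures if every member satisfies it. For sets $\mathbb{A} \supseteq \mathbb{A}^*$ of CI structures over $N$, $\mathbb{A}$ is a $k$-antecedental approximation of $\mathbb{A}^*$ if every inference form with $|\mathcal{L}| \le k$ which is valid for $\mathbb{A}^*$ is also valid for $\mathbb{A}$. *)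

theory Defs
  imports "Jordan_Normal_Form.Determinant"
begin

text \<open>The CI statement \<open>(ij|K)\<close> is the pair of the unordered pair \<open>{i,j}\<close> and \<open>K\<close>,
  so \<open>(ij|K) = (ji|K)\<close> holds by construction.\<close>

type_synonym 'a ci = "'a set \<times> 'a set"

definition ci :: "'a \<Rightarrow> 'a \<Rightarrow> 'a set \<Rightarrow> 'a ci" where
  "ci i j K = ({i, j}, K)"

definition ci_statements :: "'a set \<Rightarrow> 'a ci set" where
  "ci_statements N = {ci i j K |i j K. i \<in> N \<and> j \<in> N \<and> i \<noteq> j \<and> K \<subseteq> N - {i, j}}"

definition gaussoid :: "'a set \<Rightarrow> 'a ci set \<Rightarrow> bool" where
  "gaussoid N G \<longleftrightarrow> G \<subseteq> ci_statements N \<and>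
    (\<forall>i\<in>N. \<forall>j\<in>N. \<forall>k\<in>N. \<forall>L. i \<noteq> j \<and> i \<noteq> k \<and> j \<noteq> k \<and> L \<subseteq> N - {i, j, k} \<longrightarrow>
      (ci i j L \<in> G \<and> ci i k (insert j L) \<in> G \<longleftrightarrow> ci i k L \<in> G \<and> ci i j (insert k L) \<in> G) \<and>
      (ci i j (insert k L) \<in> G \<and> ci i k (insert j L) \<in> G \<longleftrightarrow> ci i j L \<in> G \<and> ci i k L \<in> G) \<and>
      (ci i j L \<in> G \<and> ci i j (insert k L) \<in> G \<longrightarrow> ci i k L \<in> G \<or> ci j k L \<in> G))"

text \<open>An \<open>N \<times> N\<close> matrix is a function \<open>'a \<Rightarrow> 'a \<Rightarrow> 'k\<close> of which only the values on \<open>N \<times> N\<close>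
  are used. Its submatrices become matrices of the library by listing the row and column indices.\<close>

definition submat :: "('a \<Rightarrow> 'a \<Rightarrow> 'k) \<Rightarrow> 'a list \<Rightarrow> 'a list \<Rightarrow> 'k mat" where
  "submat \<Gamma> rs cs = mat (length rs) (length cs) (\<lambda>(a, b). \<Gamma> (rs ! a) (cs ! b))"

definition enum_of :: "'a set \<Rightarrow> 'a list" where
  "enum_of I = (SOME xs. distinct xs \<and> set xs = I)"

text \<open>\<open>minor \<Gamma> I J\<close> is \<open>det \<Gamma>\<^bsub>I,J\<^esub>\<close> for finite \<open>I\<close> and \<open>J\<close> of equal size. The chosen enumerations
  influence only its sign, and not even that if \<open>I = J\<close>; see \<open>minor_eq_0_iff\<close> and
  \<open>principal_minor_eq\<close> below.\<close>

definition minor :: "('a \<Rightarrow> 'a \<Rightarrow> 'k::comm_ring_1) \<Rightarrow> 'a set \<Rightarrow> 'a set \<Rightarrow> 'k" where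
  "minor \<Gamma> I J = det (submat \<Gamma> (enum_of I) (enum_of J))"

lemma enum_of:
  assumes "finite I"
  shows "distinct (enum_of I)" "set (enum_of I) = I"
proof -
  have "\<exists>xs. distinct xs \<and> set xs = I"
    using finite_distinct_list[OF assms] by auto
  then have "distinct (enum_of I) \<and> set (enum_of I) = I"
    unfolding enum_of_def by (rule someI_ex)
  then show "distinct (enum_of I)" "set (enum_of I) = I" by auto
qed

lemma det_submat_permute_list:
  fixes \<Gamma> :: "'a \<Rightarrow> 'a \<Rightarrow> 'k::comm_ring_1"
  assumes p: "p permutes {..<n}" and q: "q permutes {..<n}"
    and rs: "length rs = n" and cs: "length cs = n"
  shows "det (submat \<Gamma> (permute_list p rs) (permute_list q cs))
    = signof p * signof q * det (submat \<Gamma> rs cs)"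
proof -
  let ?B = "mat n n (\<lambda>(a, b). (submat \<Gamma> rs cs)\<^sup>T $$ (q a, b))"
  have p': "p permutes {0..<n}" and q': "q permutes {0..<n}"
    using p q by (simp_all add: atLeast0LessThan)
  have S: "submat \<Gamma> rs cs \<in> carrier_mat n n" "(submat \<Gamma> rs cs)\<^sup>T \<in> carrier_mat n n"
    by (simp_all add: submat_def rs cs)
  have pin: "\<And>a. a < n \<Longrightarrow> p a < n" and qin: "\<And>a. a < n \<Longrightarrow> q a < n"
    using permutes_in_image[OF p] permutes_in_image[OF q] by auto
  have B: "?B\<^sup>T \<in> carrier_mat n n" by simp
  have "submat \<Gamma> (permute_list p rs) (permute_list q cs) = mat n n (\<lambda>(a, b). ?B\<^sup>T $$ (p a, b))"
    by (rule eq_matI) (auto simp: submat_def permute_list_def rs cs pin qin)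
  then have "det (submat \<Gamma> (permute_list p rs) (permute_list q cs)) = signof p * det (?B\<^sup>T)"
    using det_permute_rows[OF B p'] by simp
  also have "det (?B\<^sup>T) = det ?B"
    by (rule det_transpose[of _ n]) simp
  also have "det ?B = signof q * det (submat \<Gamma> rs cs)"
    using det_permute_rows[OF S(2) q'] det_transpose[OF S(1)] by simp
  finally show ?thesis by (simp add: mult.assoc)
qed

lemma ex_permute_list:
  assumes "distinct xs" "distinct ys" "set xs = set ys"
  obtains p where "p permutes {..<length ys}" "permute_list p ys = xs"
  using mset_eq_permutation[of xs ys] assms set_eq_iff_mset_eq_distinct by blast

lemma minor_eq_0_iff:
  fixes \<Gamma> :: "'a \<Rightarrow> 'a \<Rightarrow> 'k::comm_ring_1"
  assumes "distinct rs" "distinct cs" "length rs = length cs"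
  shows "minor \<Gamma> (set rs) (set cs) = 0 \<longleftrightarrow> det (submat \<Gamma> rs cs) = 0"
proof -
  obtain p where p: "p permutes {..<length rs}" "permute_list p rs = enum_of (set rs)"
    using ex_permute_list[of "enum_of (set rs)" rs] enum_of[of "set rs"] assms by auto
  obtain q where q: "q permutes {..<length cs}" "permute_list q cs = enum_of (set cs)"
    using ex_permute_list[of "enum_of (set cs)" cs] enum_of[of "set cs"] assms by auto
  have "minor \<Gamma> (set rs) (set cs) = signof p * signof q * det (submat \<Gamma> rs cs)"
    unfolding minor_def p(2)[symmetric] q(2)[symmetric]
    by (rule det_submat_permute_list[OF _ q(1)]) (use p assms in auto)
  then show ?thesis by (auto simp: sign_def)
qed

lemma principal_minor_eq:
  fixes \<Gamma> :: "'a \<Rightarrow> 'a \<Rightarrow> 'k::comm_ring_1"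
  assumes "distinct xs"
  shows "minor \<Gamma> (set xs) (set xs) = det (submat \<Gamma> xs xs)"
proof -
  obtain p where p: "p permutes {..<length xs}" "permute_list p xs = enum_of (set xs)"
    using ex_permute_list[of "enum_of (set xs)" xs] enum_of[of "set xs"] assms by auto
  have "minor \<Gamma> (set xs) (set xs) = signof p * signof p * det (submat \<Gamma> xs xs)"
    unfolding minor_def p(2)[symmetric]
    by (rule det_submat_permute_list[OF p(1) p(1)]) auto
  then show ?thesis by (auto simp: sign_def)
qed

definition symmetric_on :: "'a set \<Rightarrow> ('a \<Rightarrow> 'a \<Rightarrow> 'k) \<Rightarrow> bool" where
  "symmetric_on N \<Gamma> \<longleftrightarrow> (\<forall>i\<in>N. \<forall>j\<in>N. \<Gamma> i j = \<Gamma> j i)"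

definition principally_regular :: "'a set \<Rightarrow> ('a \<Rightarrow> 'a \<Rightarrow> 'k::field) \<Rightarrow> bool" where
  "principally_regular N \<Gamma> \<longleftrightarrow> symmetric_on N \<Gamma> \<and> (\<forall>K\<subseteq>N. minor \<Gamma> K K \<noteq> 0)"

definition principally_positive :: "'a set \<Rightarrow> ('a \<Rightarrow> 'a \<Rightarrow> 'k::linordered_field) \<Rightarrow> bool" where
  "principally_positive N \<Gamma> \<longleftrightarrow> symmetric_on N \<Gamma> \<and> (\<forall>K\<subseteq>N. minor \<Gamma> K K > 0)"

definition ci_structure_of :: "'a set \<Rightarrow> ('a \<Rightarrow> 'a \<Rightarrow> 'k::field) \<Rightarrow> 'a ci set" where
  "ci_structure_of N \<Gamma> = {ci i j K |i j K. i \<in> N \<and> j \<in> N \<and> i \<noteq> j \<and> K \<subseteq> N - {i, j} \<and>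
    minor \<Gamma> (insert i K) (insert j K) = 0}"

definition algebraically_realizable :: "'k::field itself \<Rightarrow> 'a set \<Rightarrow> 'a ci set \<Rightarrow> bool" where
  "algebraically_realizable _ N A \<longleftrightarrow>
    (\<exists>\<Gamma> :: 'a \<Rightarrow> 'a \<Rightarrow> 'k. principally_regular N \<Gamma> \<and> A = ci_structure_of N \<Gamma>)"

definition positively_realizable :: "'k::linordered_field itself \<Rightarrow> 'a set \<Rightarrow> 'a ci set \<Rightarrow> bool" where
  "positively_realizable _ N A \<longleftrightarrow>
    (\<exists>\<Gamma> :: 'a \<Rightarrow> 'a \<Rightarrow> 'k. principally_positive N \<Gamma> \<and> A = ci_structure_of N \<Gamma>)"

text \<open>The inference form \<open>\<And>L \<Rightarrow> \<Or>M\<close> is given by the two sets \<open>L\<close> and \<open>M\<close>.\<close>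

definition satisfies_inference :: "'a ci set \<Rightarrow> 'a ci set \<Rightarrow> 'a ci set \<Rightarrow> bool" where
  "satisfies_inference A L M \<longleftrightarrow> (L \<subseteq> A \<longrightarrow> A \<inter> M \<noteq> {})"

definition valid_inference :: "'a ci set set \<Rightarrow> 'a ci set \<Rightarrow> 'a ci set \<Rightarrow> bool" where
  "valid_inference \<AA> L M \<longleftrightarrow> (\<forall>A\<in>\<AA>. satisfies_inference A L M)"

text \<open>The requirement that the approximated set is contained in its approximation is part of the
  notion.\<close>

definition antecedental_approximation ::
  "nat \<Rightarrow> 'a set \<Rightarrow> 'a ci set set \<Rightarrow> 'a ci set set \<Rightarrow> bool" where
  "antecedental_approximation k N \<AA> \<AA>' \<longleftrightarrow>
    \<AA>' \<subseteq> \<AA> \<and> \<AA> \<subseteq> Pow (ci_statements N) \<and>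
    (\<forall>L M. L \<subseteq> ci_statements N \<and> M \<subseteq> ci_statements N \<and> card L \<le> k \<and> valid_inference \<AA>' L M
      \<longrightarrow> valid_inference \<AA> L M)"

end

(* Let G be a gaussoid and L a subset of G with at most two elements. It suffices to find a positive
   rational matrix whose CI structure lies between L and G, since it can be mapped to any field of
   characteristic zero and to any ordered field.

   Matrices are built one index at a time. Given the matrix on N - i, the statement (ij|K) is a linear
   condition on the new row, namely orthogonality to the residual of j given K. If L consists of (ij|K)
   and (il|M), start from a generic matrix and choose the row generically subject to these two
   conditions; then (ia|C) holds iff its residual is a combination of the other two, and this happens
   only where the gaussoid axioms require it. The disjunctive axiom, for (ij|I) and (ij|zI), is met by
   adding either row i or row j last. If L consists of (ij|K) and (kl|M) with i, j, k, l distinct and,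
   say, i not in M, realize (kl|M) first and add row i. In the remaining case i, j are in M and k, l
   in K, and passing to the inverse matrix, which replaces K by the complement of ijK, reduces to the
   previous one. *)

theory Submission
  imports Defs
begin

text \<open>Two kinds of unwanted statements must be kept out when an index is added. Those
  conditioned on the new index: the new diagonal entry is chosen last and so large that such a
  partial covariance vanishes only if the old one does and one of the two new covariances does too.
  Those with the new index in the pair: it must be known which residuals are combinations of the two
  prescribed ones. Coefficients and orthogonalities of residuals are, up to non-zero factors,
  partial covariances, so for a generic matrix all their zeros are known, and comparing zeros
  settles every relation except one between residuals of three distinct indices. That obstacle is
  why generic matrices are also kept \<open>dominant\<close>, which is achieved by scaling the new
  row down before the diagonal entry is chosen. The last index matters for (ij|I) and (ij|zI):
  generically, the residuals of j given I and given zI differ by a non-zero multiple of the residual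
  of z given I, so adding i last forces (iz|I), while adding j last forces (jz|I). The third axiom
  grants one of these.\<close>

section \<open>Residuals and partial covariances\<close>

text \<open>If \<open>\<Gamma>\<close> is the covariance matrix of random variables \<open>\<xi>\<close>, then \<open>residual \<Gamma> j K\<close> lists the
  coefficients of \<open>\<xi>\<^sub>j\<close> minus its projection to the span of the \<open>\<xi>\<^sub>k\<close>, \<open>k \<in> K\<close>, and \<open>pcov \<Gamma> i j K\<close> is a
  partial covariance, an entry of the Schur complement of \<open>\<Gamma>\<^bsub>K,K\<^esub>\<close>. Over a general field
  only the orthogonality to \<open>K\<close> remains.\<close>

definition app :: "('a \<Rightarrow> 'a \<Rightarrow> 'k::comm_ring_1) \<Rightarrow> 'a set \<Rightarrow> ('a \<Rightarrow> 'k) \<Rightarrow> 'a \<Rightarrow> 'k" where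
  "app \<Gamma> S v i = (\<Sum>m\<in>S. \<Gamma> i m * v m)"

definition is_residual :: "('a \<Rightarrow> 'a \<Rightarrow> 'k::comm_ring_1) \<Rightarrow> 'a \<Rightarrow> 'a set \<Rightarrow> ('a \<Rightarrow> 'k) \<Rightarrow> bool" where
  "is_residual \<Gamma> j K v \<longleftrightarrow> v j = 1 \<and> (\<forall>m. m \<notin> insert j K \<longrightarrow> v m = 0) \<and>
    (\<forall>k\<in>K. app \<Gamma> (insert j K) v k = 0)"

lemma app_cong:
  assumes "\<And>m. m \<in> S \<Longrightarrow> \<Gamma> i m = \<Gamma>' i m" "\<And>m. m \<in> S \<Longrightarrow> v m = v' m"
  shows "app \<Gamma> S v i = app \<Gamma>' S v' i"
  using assms by (simp add: app_def)

lemma app_mono_neutral: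
  assumes "finite T" "S \<subseteq> T" "\<And>m. m \<in> T - S \<Longrightarrow> v m = 0"
  shows "app \<Gamma> S v i = app \<Gamma> T v i"
  unfolding app_def by (rule sum.mono_neutral_left) (use assms in auto)

lemma app_linear:
  "app \<Gamma> S (\<lambda>m. a * u m + b * v m) i = a * app \<Gamma> S u i + b * app \<Gamma> S v i"
  unfolding app_def by (simp add: sum.distrib sum_distrib_left algebra_simps)

lemma app_diff:
  "app \<Gamma> S (\<lambda>m. u m - b * v m) i = app \<Gamma> S u i - b * app \<Gamma> S v i"
  using app_linear[of \<Gamma> S 1 u "- b" v i] by simp

lemma is_residual_cong:
  assumes "\<And>k m. k \<in> K \<Longrightarrow> m \<in> insert j K \<Longrightarrow> \<Gamma> k m = \<Gamma>' k m"
  shows "is_residual \<Gamma> j K v \<longleftrightarrow> is_residual \<Gamma>' j K v"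
  using app_cong[of "insert j K" \<Gamma> _ \<Gamma>' v v] assms unfolding is_residual_def by metis

lemma app_conv_list:
  assumes "distinct xs"
  shows "app \<Gamma> (set xs) v i = (\<Sum>b<length xs. \<Gamma> i (xs ! b) * v (xs ! b))"
proof -
  have "app \<Gamma> (set xs) v i = (\<Sum>m\<leftarrow>xs. \<Gamma> i m * v m)"
    unfolding app_def using assms by (simp add: sum_list_distinct_conv_sum_set)
  also have "\<dots> = (\<Sum>b<length xs. \<Gamma> i (xs ! b) * v (xs ! b))"
    by (simp add: sum_list_sum_nth atLeast0LessThan)
  finally show ?thesis .
qed

text \<open>Column operations with the residual turn the column of \<open>j\<close> into a multiple of a unit vector.\<close>

lemma det_submat_residual:
  fixes \<Gamma> :: "'a \<Rightarrow> 'a \<Rightarrow> 'k::comm_ring_1"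
  assumes ks: "distinct ks" and j: "j \<notin> set ks" and v: "is_residual \<Gamma> j (set ks) v"
  shows "det (submat \<Gamma> (i # ks) (j # ks)) = app \<Gamma> (insert j (set ks)) v i * det (submat \<Gamma> ks ks)"
proof -
  define n where "n = length ks"
  define A where "A = submat \<Gamma> (i # ks) (j # ks)"
  \<comment> \<open>The identity with first column replaced by the residual; \<open>v j = 1\<close>
    makes it unit triangular.\<close>
  define U where "U = mat (Suc n) (Suc n)
    (\<lambda>(a, b). if b = 0 then v ((j # ks) ! a) else if a = b then 1 else 0)"
  define B where "B = A * U"
  have A: "A \<in> carrier_mat (Suc n) (Suc n)" by (simp add: A_def submat_def n_def)
  have U: "U \<in> carrier_mat (Suc n) (Suc n)" by (simp add: U_def)
  have B: "B \<in> carrier_mat (Suc n) (Suc n)" using A U by (simp add: B_def)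
  have vj: "v j = 1" using v by (simp add: is_residual_def)
  have "diag_mat U = replicate (Suc n) 1"
    by (rule nth_equalityI) (auto simp: diag_mat_def U_def vj simp del: upt_Suc replicate_Suc)
  then have "prod_list (diag_mat U) = 1" by simp
  moreover have "det U = prod_list (diag_mat U)"
    by (rule det_lower_triangular[OF _ U]) (auto simp: U_def)
  ultimately have detB: "det B = det A" using det_mult[OF A U] by (simp add: B_def)
  have B0: "B $$ (a, 0) = app \<Gamma> (insert j (set ks)) v ((i # ks) ! a)" if "a < Suc n" for a
  proof -
    have "B $$ (a, 0) = (\<Sum>b<Suc n. \<Gamma> ((i # ks) ! a) ((j # ks) ! b) * v ((j # ks) ! b))"
      using that A U by (simp add: B_def scalar_prod_def A_def U_def submat_def n_def
          atLeast0LessThan del: sum.lessThan_Suc)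
    also have "\<dots> = app \<Gamma> (insert j (set ks)) v ((i # ks) ! a)"
      using app_conv_list[of "j # ks" \<Gamma> v "(i # ks) ! a"] ks j
      by (simp add: n_def del: sum.lessThan_Suc)
    finally show ?thesis .
  qed
  have BS: "B $$ (a, Suc b) = A $$ (a, Suc b)" if "a < Suc n" "b < n" for a b
  proof -
    have "B $$ (a, Suc b) = (\<Sum>c<Suc n. A $$ (a, c) * (if c = Suc b then 1 else 0))"
      using that A U by (simp add: B_def scalar_prod_def U_def
          atLeast0LessThan del: sum.lessThan_Suc)
    also have "\<dots> = (\<Sum>c<Suc n. if c = Suc b then A $$ (a, c) else 0)"
      by (rule sum.cong) auto
    also have "\<dots> = A $$ (a, Suc b)"
      using that by (simp add: sum.delta del: sum.lessThan_Suc)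
    finally show ?thesis .
  qed
  have Bzero: "B $$ (Suc a, 0) = 0" if "a < n" for a
    using v that by (simp add: B0 is_residual_def n_def)
  have "det B = (\<Sum>a<Suc n. B $$ (a, 0) * cofactor B a 0)"
    by (rule laplace_expansion_column[OF B]) simp
  also have "\<dots> = B $$ (0, 0) * cofactor B 0 0"
    by (simp add: sum.lessThan_Suc_shift Bzero del: sum.lessThan_Suc)
  also have "cofactor B 0 0 = det (mat_delete B 0 0)"
    by (simp add: cofactor_def)
  also have "mat_delete B 0 0 = submat \<Gamma> ks ks"
    by (rule eq_matI) (use B in \<open>auto simp: mat_delete_def BS A_def submat_def n_def\<close>)
  finally show ?thesis by (simp add: detB[symmetric] B0 A_def[symmetric])
qed

lemma minor_insert_residual:
  fixes \<Gamma> :: "'a \<Rightarrow> 'a \<Rightarrow> 'k::comm_ring_1"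
  assumes K: "finite K" and j: "j \<notin> K" and v: "is_residual \<Gamma> j K v"
  shows "minor \<Gamma> (insert j K) (insert j K) = app \<Gamma> (insert j K) v j * minor \<Gamma> K K"
proof -
  obtain ks where ks: "distinct ks" "set ks = K" using finite_distinct_list[OF K] by auto
  then show ?thesis
    using principal_minor_eq[of "j # ks" \<Gamma>] principal_minor_eq[of ks \<Gamma>]
      det_submat_residual[of ks j \<Gamma> v j] j v by simp
qed

text \<open>Rows and columns are enumerated independently in \<open>minor\<close>, so off the
  diagonal only the vanishing can be read off, not the sign.\<close>

lemma minor_residual_eq_0_iff:
  fixes \<Gamma> :: "'a \<Rightarrow> 'a \<Rightarrow> 'k::idom"
  assumes K: "finite K" and ij: "i \<notin> K" "j \<notin> K" and v: "is_residual \<Gamma> j K v"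
    and reg: "minor \<Gamma> K K \<noteq> 0"
  shows "minor \<Gamma> (insert i K) (insert j K) = 0 \<longleftrightarrow> app \<Gamma> (insert j K) v i = 0"
proof -
  obtain ks where ks: "distinct ks" "set ks = K" using finite_distinct_list[OF K] by auto
  then show ?thesis
    using minor_eq_0_iff[of "i # ks" "j # ks" \<Gamma>] principal_minor_eq[of ks \<Gamma>]
      det_submat_residual[of ks j \<Gamma> v i] ij v reg by simp
qed

lemma minor_empty: "minor \<Gamma> {} {} = 1"
  using principal_minor_eq[of "[]" \<Gamma>] by (simp add: submat_def)

lemma minor_cong:
  assumes "finite K" "\<And>a b. a \<in> K \<Longrightarrow> b \<in> K \<Longrightarrow> \<Gamma> a b = \<Gamma>' a b"
  shows "minor \<Gamma> K K = minor \<Gamma>' K K"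
proof -
  have "submat \<Gamma> (enum_of K) (enum_of K) = submat \<Gamma>' (enum_of K) (enum_of K)"
    by (rule eq_matI) (use assms enum_of[OF assms(1)] nth_mem in \<open>fastforce simp: submat_def\<close>)+
  then show ?thesis by (simp add: minor_def)
qed

text \<open>A Gram-Schmidt step: both vectors are already orthogonal to \<open>K\<close>, and the
  coefficient cancels the value at \<open>k\<close>.\<close>

lemma is_residual_combine:
  fixes \<Gamma> :: "'a \<Rightarrow> 'a \<Rightarrow> 'k::field"
  assumes K: "finite K" and jk: "j \<notin> insert k K" "k \<notin> K"
    and u: "is_residual \<Gamma> j K u" and w: "is_residual \<Gamma> k K w"
    and nz: "app \<Gamma> (insert k K) w k \<noteq> 0"
  shows "is_residual \<Gamma> j (insert k K)
    (\<lambda>m. u m - app \<Gamma> (insert j K) u k / app \<Gamma> (insert k K) w k * w m)"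
proof -
  let ?T = "insert j (insert k K)"
  have T: "app \<Gamma> (insert j K) u i = app \<Gamma> ?T u i" "app \<Gamma> (insert k K) w i = app \<Gamma> ?T w i" for i
    using u w jk K by (auto intro!: app_mono_neutral simp: is_residual_def)
  show ?thesis
    using u w jk nz unfolding is_residual_def T app_diff by auto
qed

text \<open>Gram-Schmidt over \<open>K\<close>; each pivot is a quotient of two principal minors
  inside \<open>K\<close>. Nothing is assumed about row \<open>j\<close>, so this applies before the
  diagonal entry of a new index is fixed.\<close>

lemma ex_residual:
  fixes \<Gamma> :: "'a \<Rightarrow> 'a \<Rightarrow> 'k::field"
  assumes "finite K" "\<And>K'. K' \<subseteq> K \<Longrightarrow> minor \<Gamma> K' K' \<noteq> 0" "j \<notin> K"
  shows "\<exists>v. is_residual \<Gamma> j K v"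
  using assms
proof (induction K arbitrary: j rule: finite_induct)
  case empty
  show ?case by (rule exI[of _ "\<lambda>m. if m = j then 1 else 0"]) (simp add: is_residual_def)
next
  case (insert k K)
  have reg: "minor \<Gamma> K' K' \<noteq> 0" if "K' \<subseteq> K" for K' using insert.prems(1) that by blast
  obtain u where u: "is_residual \<Gamma> j K u" using insert.IH[OF reg] insert.prems(2) by blast
  obtain w where w: "is_residual \<Gamma> k K w" using insert.IH[OF reg] insert.hyps(2) by blast
  have "minor \<Gamma> (insert k K) (insert k K) \<noteq> 0" using insert.prems(1) by blast
  then have "app \<Gamma> (insert k K) w k \<noteq> 0"
    using minor_insert_residual[OF insert.hyps w] by auto
  then show ?case
    by (intro exI, rule is_residual_combine[OF insert.hyps(1) insert.prems(2) insert.hyps(2) u w])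
qed

definition residual :: "('a \<Rightarrow> 'a \<Rightarrow> 'k::comm_ring_1) \<Rightarrow> 'a \<Rightarrow> 'a set \<Rightarrow> 'a \<Rightarrow> 'k" where
  "residual \<Gamma> j K = (SOME v. is_residual \<Gamma> j K v)"

definition pcov :: "('a \<Rightarrow> 'a \<Rightarrow> 'k::comm_ring_1) \<Rightarrow> 'a \<Rightarrow> 'a \<Rightarrow> 'a set \<Rightarrow> 'k" where
  "pcov \<Gamma> i j K = app \<Gamma> (insert j K) (residual \<Gamma> j K) i"

section \<open>Calculus of partial covariances of a principally regular matrix\<close>

locale regular_matrix =
  fixes N :: "'a set" and \<Gamma> :: "'a \<Rightarrow> 'a \<Rightarrow> 'k::field"
  assumes fin: "finite N" and reg: "principally_regular N \<Gamma>"
begin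

lemma symmetric: "a \<in> N \<Longrightarrow> b \<in> N \<Longrightarrow> \<Gamma> a b = \<Gamma> b a"
  using reg by (auto simp: principally_regular_def symmetric_on_def)

lemma minor_nz: "K \<subseteq> N \<Longrightarrow> minor \<Gamma> K K \<noteq> 0"
  using reg by (simp add: principally_regular_def)

lemma finK: "K \<subseteq> N \<Longrightarrow> finite K"
  using fin by (rule rev_finite_subset)

lemma residual:
  assumes "K \<subseteq> N" "j \<notin> K"
  shows "is_residual \<Gamma> j K (residual \<Gamma> j K)"
proof -
  have "\<exists>v. is_residual \<Gamma> j K v"
    by (rule ex_residual) (use assms finK minor_nz in auto)
  then show ?thesis unfolding residual_def by (rule someI_ex)
qed

lemma residual_self [simp]: "K \<subseteq> N \<Longrightarrow> j \<notin> K \<Longrightarrow> residual \<Gamma> j K j = 1"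
  using residual by (simp add: is_residual_def)

lemma residual_outside: "K \<subseteq> N \<Longrightarrow> j \<notin> K \<Longrightarrow> m \<notin> insert j K \<Longrightarrow> residual \<Gamma> j K m = 0"
  using residual by (simp add: is_residual_def)

lemma pcov_conv_app:
  assumes "K \<subseteq> N" "j \<in> N - K"
  shows "pcov \<Gamma> i j K = app \<Gamma> N (residual \<Gamma> j K) i"
  unfolding pcov_def
  by (rule app_mono_neutral) (use assms fin residual_outside in auto)

lemma pcov_inside: "K \<subseteq> N \<Longrightarrow> j \<notin> K \<Longrightarrow> k \<in> K \<Longrightarrow> pcov \<Gamma> k j K = 0"
  using residual by (auto simp: is_residual_def pcov_def)

lemma minor_insert: "K \<subseteq> N \<Longrightarrow> j \<notin> K \<Longrightarrow> minor \<Gamma> (insert j K) (insert j K) = pcov \<Gamma> j j K * minor \<Gamma> K K"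
  using minor_insert_residual[OF finK _ residual] by (simp add: pcov_def)

lemma pcov_nz: "K \<subseteq> N \<Longrightarrow> j \<in> N - K \<Longrightarrow> pcov \<Gamma> j j K \<noteq> 0"
  using minor_insert[of K j] minor_nz[of "insert j K"] by auto

lemma app_swap: "(\<Sum>a\<in>N. u a * app \<Gamma> N w a) = (\<Sum>a\<in>N. w a * app \<Gamma> N u a)"
proof -
  have "(\<Sum>a\<in>N. u a * app \<Gamma> N w a) = (\<Sum>a\<in>N. \<Sum>b\<in>N. w b * (\<Gamma> b a * u a))"
    unfolding app_def sum_distrib_left
    by (intro sum.cong refl) (simp add: symmetric mult_ac)
  also have "\<dots> = (\<Sum>b\<in>N. \<Sum>a\<in>N. w b * (\<Gamma> b a * u a))" by (rule sum.swap)
  finally show ?thesis by (simp add: app_def sum_distrib_left)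
qed

text \<open>Coefficients on \<open>K\<close> meet zeros of \<open>w\<close>, and the remaining
  coefficient, at \<open>i\<close>, is 1.\<close>

lemma residual_sum_pcov:
  assumes "K \<subseteq> N" "i \<in> N - K" and w: "\<And>k. k \<in> K \<Longrightarrow> w k = 0"
  shows "(\<Sum>a\<in>N. residual \<Gamma> i K a * w a) = w i"
proof -
  have "(\<Sum>a\<in>N. residual \<Gamma> i K a * w a) = (\<Sum>a\<in>{i}. residual \<Gamma> i K a * w a)"
    by (rule sum.mono_neutral_right)
      (use assms(1,2) w residual_outside[of K i] fin in \<open>auto simp del: mult_eq_0_iff\<close>, auto)
  then show ?thesis using assms by simp
qed

text \<open>Both sides are the value of the symmetric bilinear form of \<Gamma> at the residuals of
  \<open>i\<close> and \<open>j\<close>.\<close>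

lemma pcov_sym:
  assumes K: "K \<subseteq> N" and ij: "i \<in> N - K" "j \<in> N - K"
  shows "pcov \<Gamma> i j K = pcov \<Gamma> j i K"
proof -
  have "pcov \<Gamma> i j K = (\<Sum>a\<in>N. residual \<Gamma> i K a * pcov \<Gamma> a j K)"
    by (rule residual_sum_pcov[symmetric]) (use assms pcov_inside in auto)
  also have "\<dots> = (\<Sum>a\<in>N. residual \<Gamma> j K a * pcov \<Gamma> a i K)"
    using assms app_swap[of "residual \<Gamma> i K" "residual \<Gamma> j K"] by (simp add: pcov_conv_app)
  also have "\<dots> = pcov \<Gamma> j i K"
    by (rule residual_sum_pcov) (use assms pcov_inside in auto)
  finally show ?thesis .
qed

text \<open>Pairing \<open>d\<close> with the residual of \<open>m\<close> given
  \<open>S - {m}\<close> isolates \<open>d m\<close> times a non-zero pivot.\<close>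

lemma kernel_trivial:
  assumes S: "S \<subseteq> N" and out: "\<And>m. m \<notin> S \<Longrightarrow> d m = 0" and ker: "\<And>m. m \<in> S \<Longrightarrow> app \<Gamma> N d m = 0"
  shows "d m = 0"
proof (cases "m \<in> S")
  case True
  let ?K = "S - {m}"
  have K: "?K \<subseteq> N" "m \<in> N - ?K" using S True by auto
  have "0 = (\<Sum>a\<in>N. residual \<Gamma> m ?K a * app \<Gamma> N d a)"
    using ker residual_outside[OF K(1)] True
    by (intro sum.neutral[symmetric]) (metis Diff_iff insertI1 insert_Diff mult_eq_0_iff)
  also have "\<dots> = (\<Sum>a\<in>N. d a * pcov \<Gamma> a m ?K)"
    using app_swap[of "residual \<Gamma> m ?K" d] pcov_conv_app[OF K] by simp
  also have "\<dots> = (\<Sum>a\<in>{m}. d a * pcov \<Gamma> a m ?K)"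
    by (rule sum.mono_neutral_right) (use fin K out pcov_inside[OF K(1), of m] in auto)
  finally show ?thesis using pcov_nz[OF K] by simp
qed (use out in simp)

lemma residual_unique:
  assumes K: "K \<subseteq> N" and j: "j \<in> N - K" and v: "is_residual \<Gamma> j K v"
  shows "residual \<Gamma> j K = v"
proof
  fix m
  let ?d = "\<lambda>m. residual \<Gamma> j K m - 1 * v m"
  have v': "app \<Gamma> N v k = app \<Gamma> (insert j K) v k" for k
    by (rule app_mono_neutral[symmetric]) (use v fin K j in \<open>auto simp: is_residual_def\<close>)
  have "?d m = 0"
  proof (rule kernel_trivial[OF K])
    show "?d m = 0" if "m \<notin> K" for m
      using that v K j by (cases "m = j") (auto simp: residual_outside is_residual_def)
    show "app \<Gamma> N ?d k = 0" if "k \<in> K" for k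
      using pcov_inside[of K j k] pcov_conv_app[OF K j, of k] v v'[of k] that j K
      unfolding app_diff by (auto simp: is_residual_def)
  qed
  then show "residual \<Gamma> j K m = v m" by simp
qed

lemma residual_insert:
  assumes "K \<subseteq> N" "k \<in> N - K" "j \<in> N - insert k K"
  shows "residual \<Gamma> j (insert k K) m
    = residual \<Gamma> j K m - pcov \<Gamma> k j K / pcov \<Gamma> k k K * residual \<Gamma> k K m"
proof -
  have "is_residual \<Gamma> j (insert k K)
    (\<lambda>m. residual \<Gamma> j K m - pcov \<Gamma> k j K / pcov \<Gamma> k k K * residual \<Gamma> k K m)"
    unfolding pcov_def
    by (rule is_residual_combine) (use assms finK residual pcov_nz in \<open>auto simp flip: pcov_def\<close>)
  from residual_unique[OF _ _ this] show ?thesis using assms by simp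
qed

text \<open>Condition on \<open>m\<close> last: the only contribution at \<open>m\<close> comes from
  the subtracted multiple of the residual of \<open>m\<close>. Hence zeros of coefficients are CI
  statements.\<close>

lemma residual_inside:
  assumes "K \<subseteq> N" "j \<in> N - K" "m \<in> K"
  shows "residual \<Gamma> j K m = - pcov \<Gamma> m j (K - {m}) / pcov \<Gamma> m m (K - {m})"
proof -
  have "K - {m} \<subseteq> N" "m \<in> N - (K - {m})" "j \<in> N - insert m (K - {m})" "m \<noteq> j"
    using assms by auto
  then show ?thesis
    using residual_insert[of "K - {m}" m j m] residual_outside[of "K - {m}" j m]
    by (simp add: insert_absorb[OF assms(3)])
qed

text \<open>The Schur complement recursion, from which the gaussoid axioms and the effect of a new
  index are both derived.\<close>

lemma pcov_insert:
  assumes "K \<subseteq> N" "k \<in> N - K" "j \<in> N - insert k K"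
  shows "pcov \<Gamma> i j (insert k K) = pcov \<Gamma> i j K - pcov \<Gamma> i k K * pcov \<Gamma> k j K / pcov \<Gamma> k k K"
proof -
  have "pcov \<Gamma> i j (insert k K)
    = app \<Gamma> N (\<lambda>m. residual \<Gamma> j K m - pcov \<Gamma> k j K / pcov \<Gamma> k k K * residual \<Gamma> k K m) i"
    using assms residual_insert[OF assms] by (subst pcov_conv_app) (auto intro: app_cong)
  also have "\<dots> = pcov \<Gamma> i j K - pcov \<Gamma> k j K / pcov \<Gamma> k k K * pcov \<Gamma> i k K"
    unfolding app_diff using assms by (simp add: pcov_conv_app)
  finally show ?thesis by (simp add: mult.commute)
qed

text \<open>The definition may present the unordered pair in either order; \<open>pcov_sym\<close>
  reconciles the two.\<close>

lemma ci_mem_iff: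
  assumes "i \<in> N" "j \<in> N" "i \<noteq> j" "K \<subseteq> N - {i, j}"
  shows "ci i j K \<in> ci_structure_of N \<Gamma> \<longleftrightarrow> pcov \<Gamma> i j K = 0"
proof -
  have K: "K \<subseteq> N" "i \<in> N - K" "j \<in> N - K" using assms by auto
  have *: "minor \<Gamma> (insert a K) (insert b K) = 0 \<longleftrightarrow> pcov \<Gamma> a b K = 0"
    if "a \<in> N - K" "b \<in> N - K" for a b
    unfolding pcov_def
    by (rule minor_residual_eq_0_iff) (use that K finK residual minor_nz in auto)
  have "ci i j K \<in> ci_structure_of N \<Gamma> \<longleftrightarrow>
    minor \<Gamma> (insert i K) (insert j K) = 0 \<or> minor \<Gamma> (insert j K) (insert i K) = 0"
  proof
    assume "ci i j K \<in> ci_structure_of N \<Gamma>"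
    then obtain a b C where "{i, j} = {a, b}" "K = C" "minor \<Gamma> (insert a C) (insert b C) = 0"
      unfolding ci_structure_of_def ci_def by blast
    then show "minor \<Gamma> (insert i K) (insert j K) = 0 \<or> minor \<Gamma> (insert j K) (insert i K) = 0"
      by (metis doubleton_eq_iff)
  next
    have "ci i j K = ci j i K" "K \<subseteq> N - {j, i}" using assms by (auto simp: ci_def)
    moreover assume "minor \<Gamma> (insert i K) (insert j K) = 0 \<or> minor \<Gamma> (insert j K) (insert i K) = 0"
    ultimately show "ci i j K \<in> ci_structure_of N \<Gamma>"
      using assms unfolding ci_structure_of_def by blast
  qed
  then show ?thesis
    using *[of i j] *[of j i] pcov_sym[of K i j] K by metis
qed

lemma ci_structure_subset: "ci_structure_of N \<Gamma> \<subseteq> ci_statements N"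
  unfolding ci_structure_of_def ci_statements_def by blast

text \<open>By \<open>pcov_insert\<close> all three axioms become algebra in the symmetric 3 by 3
  matrix of partial covariances of \<open>i\<close>, \<open>j\<close>, \<open>k\<close> given
  \<open>L\<close>.\<close>

lemma gaussoid: "gaussoid N (ci_structure_of N \<Gamma>)"
  unfolding gaussoid_def
proof (intro conjI[OF ci_structure_subset] ballI allI impI, elim conjE)
  fix i j k L
  assume N: "i \<in> N" "j \<in> N" "k \<in> N" and ne: "i \<noteq> j" "i \<noteq> k" "j \<noteq> k"
    and L: "L \<subseteq> N - {i, j, k}"
  let ?p = "\<lambda>a b. pcov \<Gamma> a b L"
  have nz: "?p j j \<noteq> 0" "?p k k \<noteq> 0" "pcov \<Gamma> k k (insert j L) \<noteq> 0"
    using N ne L pcov_nz[of L j] pcov_nz[of L k] pcov_nz[of "insert j L" k] by (blast, blast, blast)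
  have s: "?p j i = ?p i j" "?p k i = ?p i k" "?p k j = ?p j k"
    using N ne L by (auto intro!: pcov_sym)
  have 1: "pcov \<Gamma> i j (insert k L) = ?p i j - ?p i k * ?p k j / ?p k k"
    "pcov \<Gamma> i k (insert j L) = ?p i k - ?p i j * ?p j k / ?p j j"
    "pcov \<Gamma> k k (insert j L) = ?p k k - ?p k j * ?p j k / ?p j j"
    using N ne L by (auto intro!: pcov_insert)
  have c: "ci i j L \<in> ci_structure_of N \<Gamma> \<longleftrightarrow> ?p i j = 0"
    "ci i k L \<in> ci_structure_of N \<Gamma> \<longleftrightarrow> ?p i k = 0"
    "ci j k L \<in> ci_structure_of N \<Gamma> \<longleftrightarrow> ?p j k = 0"
    "ci i j (insert k L) \<in> ci_structure_of N \<Gamma> \<longleftrightarrow> ?p i j - ?p i k * ?p j k / ?p k k = 0"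
    "ci i k (insert j L) \<in> ci_structure_of N \<Gamma> \<longleftrightarrow> ?p i k - ?p i j * ?p j k / ?p j j = 0"
    using N ne L 1 s by (subst ci_mem_iff; force)+
  \<comment> \<open>The 2 by 2 minor on \<open>j\<close>, \<open>k\<close> given \<open>L\<close>,
    non-zero because its second pivot is.\<close>
  have d: "?p j j * ?p k k \<noteq> ?p j k * ?p j k"
    using nz 1(3) s by (auto simp: field_simps)
  \<comment> \<open>The hypotheses are a homogeneous linear system in \<open>?p i j\<close> and
    \<open>?p i k\<close> whose determinant is the minor in \<open>d\<close>.\<close>
  have "?p i j = 0" if "?p i j - ?p i k * ?p j k / ?p k k = 0" "?p i k - ?p i j * ?p j k / ?p j j = 0"
  proof -
    have *: "?p i j * ?p k k = ?p i k * ?p j k" "?p i k * ?p j j = ?p i j * ?p j k"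
      using that nz by (simp_all add: field_simps)
    have "?p i j * (?p j j * ?p k k) = ?p j j * (?p i k * ?p j k)"
      unfolding *(1)[symmetric] by simp
    also have "\<dots> = ?p j k * (?p i j * ?p j k)" unfolding *(2)[symmetric] by simp
    finally have "?p i j * (?p j j * ?p k k - ?p j k * ?p j k) = 0"
      by (simp add: algebra_simps)
    then show ?thesis using d by simp
  qed
  then have 2: "(?p i j - ?p i k * ?p j k / ?p k k = 0 \<and> ?p i k - ?p i j * ?p j k / ?p j j = 0)
      = (?p i j = 0 \<and> ?p i k = 0)"
    by (metis diff_zero div_0 mult_zero_left)
  have 3: "(?p i j = 0 \<and> ?p i k - ?p i j * ?p j k / ?p j j = 0)
      = (?p i k = 0 \<and> ?p i j - ?p i k * ?p j k / ?p k k = 0)"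
    by (metis diff_zero div_0 mult_zero_left)
  have 4: "?p i j = 0 \<and> ?p i j - ?p i k * ?p j k / ?p k k = 0 \<longrightarrow> ?p i k = 0 \<or> ?p j k = 0"
    using nz by auto
  show "(ci i j L \<in> ci_structure_of N \<Gamma> \<and> ci i k (insert j L) \<in> ci_structure_of N \<Gamma>) =
       (ci i k L \<in> ci_structure_of N \<Gamma> \<and> ci i j (insert k L) \<in> ci_structure_of N \<Gamma>) \<and>
       (ci i j (insert k L) \<in> ci_structure_of N \<Gamma> \<and> ci i k (insert j L) \<in> ci_structure_of N \<Gamma>) =
       (ci i j L \<in> ci_structure_of N \<Gamma> \<and> ci i k L \<in> ci_structure_of N \<Gamma>) \<and>
       (ci i j L \<in> ci_structure_of N \<Gamma> \<and> ci i j (insert k L) \<in> ci_structure_of N \<Gamma> \<longrightarrow>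
        ci i k L \<in> ci_structure_of N \<Gamma> \<or> ci j k L \<in> ci_structure_of N \<Gamma>)"
    unfolding c using 2 3 4 by blast
qed

end

section \<open>Generic rows\<close>

text \<open>An invariant of the generic matrices: it bounds every coefficient of a residual other
  than the leading 1 by 1 in absolute value, see \<open>residual_less_1\<close>.\<close>

definition dominant :: "'a set \<Rightarrow> ('a \<Rightarrow> 'a \<Rightarrow> 'k::linordered_field) \<Rightarrow> bool" where
  "dominant N \<Gamma> \<longleftrightarrow>
    (\<forall>K\<subseteq>N. \<forall>i\<in>N - K. \<forall>j\<in>N - K. i \<noteq> j \<longrightarrow> \<bar>pcov \<Gamma> i j K\<bar> < pcov \<Gamma> i i K)"

text \<open>With \<open>r\<close> the future row of an index \<open>n\<close>, pairing it with the
  residual of \<open>j\<close> given \<open>K\<close> yields the partial covariance of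
  \<open>n\<close> and \<open>j\<close> given \<open>K\<close> before the larger matrix
  exists.\<close>

definition dot :: "'a set \<Rightarrow> ('a \<Rightarrow> 'k) \<Rightarrow> ('a \<Rightarrow> 'k) \<Rightarrow> 'k::comm_ring_1" where
  "dot N r w = (\<Sum>m\<in>N. r m * w m)"

lemma dot_linear_left: "dot N (\<lambda>m. a * r m + b * s m) w = a * dot N r w + b * dot N s w"
  by (simp add: dot_def sum.distrib sum_distrib_left algebra_simps)

lemma dot_linear_right: "dot N r (\<lambda>m. a * v m + b * w m) = a * dot N r v + b * dot N r w"
  by (simp add: dot_def sum.distrib sum_distrib_left algebra_simps)

lemma dot_zero_left [simp]: "dot N (\<lambda>m. 0) w = 0"
  by (simp add: dot_def)

text \<open>The contrapositive of a standard fact on the subspace \<open>P\<close>: a functional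
  that vanishes on the kernel of another is a multiple of it.\<close>

lemma separate_hyperplane:
  fixes w f :: "'a \<Rightarrow> 'k::field"
  assumes P: "\<And>r s a b. P r \<Longrightarrow> P s \<Longrightarrow> P (\<lambda>m. a * r m + b * s m)"
    and ex: "\<And>\<alpha>. \<exists>r. P r \<and> dot N r f \<noteq> \<alpha> * dot N r w"
  shows "\<exists>r. P r \<and> dot N r w = 0 \<and> dot N r f \<noteq> 0"
proof (cases "\<exists>s. P s \<and> dot N s w \<noteq> 0")
  case True
  then obtain s where s: "P s" "dot N s w \<noteq> 0" by blast
  \<comment> \<open>With this multiplier, moving \<open>r\<close> along \<open>s\<close> into the
    kernel of \<open>w\<close> cannot make \<open>f\<close> vanish.\<close>
  obtain r where r: "P r" "dot N r f \<noteq> dot N s f / dot N s w * dot N r w" using ex by blast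
  let ?r = "\<lambda>m. 1 * r m + (- dot N r w / dot N s w) * s m"
  have "P ?r" using r s P by blast
  moreover have "dot N ?r w = 0" "dot N ?r f \<noteq> 0"
    unfolding dot_linear_left using r s by (simp_all add: mult.commute)
  ultimately show ?thesis by blast
qed (use ex[of 0] in auto)

text \<open>Separation twice: each \<open>f - \<beta> w'\<close> from \<open>w\<close> on the whole
  space, then \<open>f\<close> from \<open>w'\<close> on the kernel of \<open>w\<close>.\<close>

lemma separate_two_hyperplanes:
  fixes w w' f :: "'a \<Rightarrow> 'k::field"
  assumes N: "finite N" and f: "\<And>\<alpha> \<beta>. \<exists>m\<in>N. f m \<noteq> \<alpha> * w m + \<beta> * w' m"
  shows "\<exists>r. (dot N r w = 0 \<and> dot N r w' = 0) \<and> dot N r f \<noteq> 0"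
proof -
  have "\<exists>r. dot N r w = 0 \<and> dot N r (\<lambda>m. f m - \<beta> * w' m) \<noteq> 0" for \<beta>
  proof -
    have "\<exists>r. True \<and> dot N r (\<lambda>m. f m - \<beta> * w' m) \<noteq> \<alpha> * dot N r w" for \<alpha>
    proof -
      obtain m where m: "m \<in> N" "f m \<noteq> \<alpha> * w m + \<beta> * w' m" using f by blast
      have "dot N (\<lambda>a. if a = m then 1 else 0) v = v m" for v :: "'a \<Rightarrow> 'k"
        using m N by (simp add: dot_def if_distrib[of "\<lambda>x. x * _"] cong: if_cong)
      moreover have "f m - \<beta> * w' m \<noteq> \<alpha> * w m" using m by (simp add: diff_eq_eq)
      ultimately show ?thesis by (intro exI[of _ "\<lambda>a. if a = m then 1 else 0"]) simp
    qed
    from separate_hyperplane[of "\<lambda>_. True", OF _ this] show ?thesis by simp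
  qed
  moreover have "dot N r (\<lambda>m. f m - \<beta> * w' m) = dot N r f - \<beta> * dot N r w'" for r \<beta>
    using dot_linear_right[of N r 1 f "- \<beta>" w'] by simp
  ultimately have "\<exists>r. dot N r w = 0 \<and> dot N r f \<noteq> \<beta> * dot N r w'" for \<beta>
    by simp
  from separate_hyperplane[of "\<lambda>r. dot N r w = 0", OF _ this]
  show ?thesis by (simp add: dot_linear_left)
qed

text \<open>Over an infinite field a subspace is not a finite union of proper subspaces: on the line
  \<open>r + t s\<close> each functional excludes at most one \<open>t\<close>.\<close>

lemma avoid_hyperplanes:
  fixes F :: "('a \<Rightarrow> 'k::field_char_0) set"
  assumes "finite F" and zero: "P (\<lambda>m. 0)"
    and P: "\<And>r s a b. P r \<Longrightarrow> P s \<Longrightarrow> P (\<lambda>m. a * r m + b * s m)"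
    and "\<And>f. f \<in> F \<Longrightarrow> \<exists>r. P r \<and> dot N r f \<noteq> 0"
  shows "\<exists>r. P r \<and> (\<forall>f\<in>F. dot N r f \<noteq> 0)"
  using assms(1,4)
proof (induction F rule: finite_induct)
  case empty
  show ?case using zero by auto
next
  case (insert f F)
  obtain r where r: "P r" "\<And>g. g \<in> F \<Longrightarrow> dot N r g \<noteq> 0" using insert.IH insert.prems by blast
  obtain s where s: "P s" "dot N s f \<noteq> 0" using insert.prems by blast
  \<comment> \<open>If \<open>dot N s g = 0\<close>, the quotient is 0 by convention; such a
    \<open>g\<close> differs from \<open>f\<close> and keeps its non-zero value at \<open>r\<close>
    along the whole line.\<close>
  have "finite ((\<lambda>g. - dot N r g / dot N s g) ` insert f F)" using insert.hyps by simp
  then obtain t where t: "t \<notin> (\<lambda>g. - dot N r g / dot N s g) ` insert f F"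
    using ex_new_if_finite[OF infinite_UNIV_char_0] by blast
  have "dot N (\<lambda>m. 1 * r m + t * s m) g \<noteq> 0" if "g \<in> insert f F" for g
  proof (cases "dot N s g = 0")
    case True
    then show ?thesis unfolding dot_linear_left using that r s by auto
  next
    case False
    show ?thesis
    proof
      assume "dot N (\<lambda>m. 1 * r m + t * s m) g = 0"
      then have "t = - dot N r g / dot N s g"
        unfolding dot_linear_left using False by (simp add: field_simps eq_neg_iff_add_eq_0)
      then show False using t that by blast
    qed
  qed
  then show ?case using P[OF r(1) s(1)] by blast
qed

text \<open>The case \<open>w = w'\<close> gives one constraint and \<open>w = w' = 0\<close>
  none.\<close>

lemma generic_row:
  fixes F :: "('a \<Rightarrow> 'k::field_char_0) set"
  assumes "finite N" "finite F"
    and "\<And>f \<alpha> \<beta>. f \<in> F \<Longrightarrow> \<exists>m\<in>N. f m \<noteq> \<alpha> * w m + \<beta> * w' m"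
  shows "\<exists>r. dot N r w = 0 \<and> dot N r w' = 0 \<and> (\<forall>f\<in>F. dot N r f \<noteq> 0)"
proof -
  have "\<exists>r. (dot N r w = 0 \<and> dot N r w' = 0) \<and> (\<forall>f\<in>F. dot N r f \<noteq> 0)"
    using assms(2)
  proof (rule avoid_hyperplanes)
    fix f assume "f \<in> F"
    with assms(3) show "\<exists>r. (dot N r w = 0 \<and> dot N r w' = 0) \<and> dot N r f \<noteq> 0"
      by (intro separate_two_hyperplanes[OF assms(1)]) blast
  qed (simp_all add: dot_linear_left)
  then show ?thesis by simp
qed

section \<open>Adding an index to a positive matrix\<close>

locale positive_matrix =
  fixes N :: "'a set" and \<Gamma> :: "'a \<Rightarrow> 'a \<Rightarrow> 'k::linordered_field"
  assumes finite_N: "finite N" and pos: "principally_positive N \<Gamma>"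
begin

sublocale regular_matrix N \<Gamma>
proof
  show "finite N" by (fact finite_N)
  have "minor \<Gamma> K K \<noteq> 0" if "K \<subseteq> N" for K
    using pos that unfolding principally_positive_def by (metis less_irrefl)
  then show "principally_regular N \<Gamma>"
    using pos by (simp add: principally_positive_def principally_regular_def)
qed

lemma minor_pos: "K \<subseteq> N \<Longrightarrow> minor \<Gamma> K K > 0"
  using pos by (simp add: principally_positive_def)

lemma pcov_pos: "K \<subseteq> N \<Longrightarrow> j \<in> N - K \<Longrightarrow> pcov \<Gamma> j j K > 0"
  using minor_insert[of K j] minor_pos[of K] minor_pos[of "insert j K"]
  by (simp add: zero_less_mult_iff)

lemma pcov_extend:
  assumes \<Gamma>': "positive_matrix (insert n N) \<Gamma>'" and eq: "\<forall>a\<in>N. \<forall>b\<in>N. \<Gamma>' a b = \<Gamma> a b"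
    and K: "K \<subseteq> N" "j \<in> N - K"
  shows "residual \<Gamma>' j K = residual \<Gamma> j K"
    and "i \<in> N \<Longrightarrow> pcov \<Gamma>' i j K = pcov \<Gamma> i j K"
    and "pcov \<Gamma>' n j K = dot N (\<Gamma>' n) (residual \<Gamma> j K)"
proof -
  interpret E: positive_matrix "insert n N" \<Gamma>' by (fact \<Gamma>')
  have "is_residual \<Gamma>' j K (residual \<Gamma> j K)"
    using residual[of K j] is_residual_cong[of K j \<Gamma> \<Gamma>' "residual \<Gamma> j K"] K eq
    by (metis Diff_iff insert_iff subsetD)
  then show r: "residual \<Gamma>' j K = residual \<Gamma> j K"
    using E.residual_unique K by blast
  show "pcov \<Gamma>' i j K = pcov \<Gamma> i j K" if "i \<in> N"
    unfolding pcov_def r by (rule app_cong) (use that K eq in auto)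
  have "pcov \<Gamma>' n j K = app \<Gamma>' N (residual \<Gamma> j K) n"
    unfolding pcov_def r
    by (rule app_mono_neutral) (use K finite_N residual_outside in auto)
  then show "pcov \<Gamma>' n j K = dot N (\<Gamma>' n) (residual \<Gamma> j K)"
    by (simp add: dot_def app_def)
qed

text \<open>Orthogonality to \<open>K\<close> tests only the rows in \<open>K\<close>, so the
  diagonal entry at \<open>n\<close> does not enter the residuals of \<open>n\<close> and shifts all
  \<open>pcov \<Gamma>' n n K\<close> equally. The new principal minors are these values times old
  minors.\<close>

lemma ex_extension:
  assumes n: "n \<notin> N"
  shows "\<exists>\<Gamma>'. principally_positive (insert n N) \<Gamma>' \<and> (\<forall>a\<in>N. \<forall>b\<in>N. \<Gamma>' a b = \<Gamma> a b) \<and>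
    (\<forall>b\<in>N. \<Gamma>' n b = r b) \<and> (\<forall>K\<subseteq>N. pcov \<Gamma>' n n K > c)"
proof -
  let ?E = "\<lambda>x a b. if a = n then if b = n then x else r b else if b = n then r a else \<Gamma> a b"
  have minor_E: "minor (?E x) K K = minor \<Gamma> K K" if "K \<subseteq> N" for x K
    by (rule minor_cong) (use that n finK in auto)
  \<comment> \<open>The diagonal entry 0 is a placeholder; these residuals serve for every
    \<open>x\<close>.\<close>
  define w where "w = residual (?E 0) n"
  have w: "is_residual (?E 0) n K (w K)" if K: "K \<subseteq> N" for K
  proof -
    have "minor (?E 0) K' K' \<noteq> 0" if "K' \<subseteq> K" for K'
      unfolding minor_E[OF order.trans[OF that K]] by (rule minor_nz[OF order.trans[OF that K]])
    then have "\<exists>v. is_residual (?E 0) n K v"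
      by (rule ex_residual[OF finK[OF K]]) (use n K in auto)
    then show ?thesis unfolding residual_def w_def by (rule someI_ex)
  qed
  \<comment> \<open>The sum outweighs the contribution of the row for each \<open>K\<close>; the
    absolute value of \<open>c\<close> ensures positivity also for negative
    \<open>c\<close>.\<close>
  define x where "x = 1 + \<bar>c\<bar> + (\<Sum>K\<in>Pow N. \<bar>dot K r (w K)\<bar>)"
  let ?\<Gamma> = "?E x"
  have wx: "is_residual ?\<Gamma> n K (w K)" if "K \<subseteq> N" for K
  proof -
    have "is_residual (?E 0) n K (w K) = is_residual ?\<Gamma> n K (w K)"
      by (rule is_residual_cong) (use that n in auto)
    then show ?thesis using w[OF that] by blast
  qed
  have val: "app ?\<Gamma> (insert n K) (w K) n > \<bar>c\<bar>" if K: "K \<subseteq> N" for K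
  proof -
    have nK: "n \<notin> K" "finite K" using K n finK by auto
    have "app ?\<Gamma> K (w K) n = dot K r (w K)"
      unfolding app_def dot_def by (rule sum.cong) (use nK in auto)
    moreover have "w K n = 1" using w[OF K] by (simp add: is_residual_def)
    ultimately have "app ?\<Gamma> (insert n K) (w K) n = x + dot K r (w K)"
      using nK by (simp add: app_def)
    moreover have "\<bar>dot K r (w K)\<bar> \<le> (\<Sum>K\<in>Pow N. \<bar>dot K r (w K)\<bar>)"
      by (rule member_le_sum) (use K finite_N in auto)
    ultimately show ?thesis unfolding x_def by linarith
  qed
  have sym: "symmetric_on (insert n N) ?\<Gamma>"
    using symmetric by (auto simp: symmetric_on_def)
  have "minor ?\<Gamma> K K > 0" if "K \<subseteq> insert n N" for K
  proof (cases "n \<in> K")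
    case True
    define J where "J = K - {n}"
    have J: "J \<subseteq> N" "n \<notin> J" "K = insert n J" using that True by (auto simp: J_def)
    have "minor ?\<Gamma> K K = app ?\<Gamma> (insert n J) (w J) n * minor ?\<Gamma> J J"
      unfolding J(3) by (rule minor_insert_residual) (use J finK wx in auto)
    moreover have "app ?\<Gamma> (insert n J) (w J) n > 0" using val[OF J(1)] by linarith
    moreover have "minor ?\<Gamma> J J > 0" using minor_pos[OF J(1)] minor_E[OF J(1), of x] by simp
    ultimately show ?thesis by simp
  next
    case False
    then have "K \<subseteq> N" using that by auto
    then show ?thesis using minor_pos minor_E[of K x] by simp
  qed
  then have pp: "principally_positive (insert n N) ?\<Gamma>" using sym by (simp add: principally_positive_def)
  then interpret E: positive_matrix "insert n N" ?\<Gamma> by unfold_locales (use finite_N in auto)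
  have "pcov ?\<Gamma> n n K > c" if "K \<subseteq> N" for K
  proof -
    have "K \<subseteq> insert n N" "n \<in> insert n N - K" using that n by auto
    then have "residual ?\<Gamma> n K = w K" using wx[OF that] by (rule E.residual_unique)
    then show ?thesis using val[OF that] by (simp only: pcov_def)
  qed
  moreover have "\<forall>a\<in>N. \<forall>b\<in>N. ?\<Gamma> a b = \<Gamma> a b" "\<forall>b\<in>N. ?\<Gamma> n b = r b" using n by auto
  ultimately show ?thesis using pp by (intro exI conjI allI impI)
qed

end

section \<open>Extending a matrix by one row\<close>

lemma ci_commute: "ci i j K = ci j i K"
  by (auto simp: ci_def)

lemma ci_eq_iff: "ci i j K = ci k l M \<longleftrightarrow> K = M \<and> (i = k \<and> j = l \<or> i = l \<and> j = k)"
  by (auto simp: ci_def doubleton_eq_iff)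

lemma (in regular_matrix) ci_structureE:
  assumes "s \<in> ci_structure_of N \<Gamma>"
  obtains i j K where "s = ci i j K" "K \<subseteq> N" "i \<in> N - K" "j \<in> N - K" "i \<noteq> j" "pcov \<Gamma> i j K = 0"
proof -
  from assms obtain i j K where s: "s = ci i j K" "i \<in> N" "j \<in> N" "i \<noteq> j" "K \<subseteq> N - {i, j}"
    unfolding ci_structure_of_def by blast
  then have "pcov \<Gamma> i j K = 0" using assms ci_mem_iff by blast
  with s that show thesis by blast
qed

lemma (in regular_matrix) ci_mem_iff':
  assumes "K \<subseteq> N" "i \<in> N - K" "j \<in> N - K" "i \<noteq> j"
  shows "ci i j K \<in> ci_structure_of N \<Gamma> \<longleftrightarrow> pcov \<Gamma> i j K = 0"
  using assms by (intro ci_mem_iff) auto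

text \<open>For non-zero \<open>p\<close> the bound makes \<open>x / P\<close> smaller than
  \<open>p\<close> in absolute value; for \<open>p = 0\<close> it degenerates to
  \<open>P > 0\<close>.\<close>

lemma large_denominator_eq_0_iff:
  fixes p :: "'k::linordered_field"
  assumes "P > 0" "P > \<bar>x\<bar> / \<bar>p\<bar>"
  shows "p - x / P = 0 \<longleftrightarrow> p = 0 \<and> x = 0"
proof -
  have False if "p \<noteq> 0" "p - x / P = 0"
  proof -
    have "p * P = x" using that assms by (simp add: field_simps)
    then have "\<bar>p\<bar> * P = \<bar>x\<bar>" using assms by (metis abs_mult abs_of_pos)
    then show False using assms that by (simp add: field_simps)
  qed
  then show ?thesis using assms(1) by (cases "p = 0") auto
qed

text \<open>The corrections of an off-diagonal and a diagonal partial covariance together stay below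
  the gap \<open>q - \<bar>p\<bar>\<close>.\<close>

lemma large_denominator_less:
  fixes p :: "'k::linordered_field"
  assumes "P > 0" "\<bar>p\<bar> < q" "P > (\<bar>x\<bar> + y * y) / \<bar>q - \<bar>p\<bar>\<bar>"
  shows "\<bar>p - x / P\<bar> < q - y * y / P"
proof -
  have "\<bar>x\<bar> + y * y < (q - \<bar>p\<bar>) * P"
    using assms by (simp add: field_simps)
  then have "(\<bar>x\<bar> + y * y) / P < q - \<bar>p\<bar>"
    using assms(1) by (simp add: pos_divide_less_eq)
  moreover have "\<bar>x / P\<bar> = \<bar>x\<bar> / P" using assms(1) by simp
  ultimately show ?thesis
    using abs_triangle_ineq4[of p "x / P"] unfolding add_divide_distrib by linarith
qed

text \<open>The diagonal entry at \<open>n\<close> is chosen so large that conditioning on \<open>n\<close> only perturbs the other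
  partial covariances slightly.\<close>

lemma (in positive_matrix) extension:
  assumes n: "n \<notin> N"
  obtains \<Gamma>' :: "'a \<Rightarrow> 'a \<Rightarrow> 'k" where "principally_positive (insert n N) \<Gamma>'"
    "ci_structure_of (insert n N) \<Gamma>' = ci_structure_of N \<Gamma> \<union>
      {ci n j K |j K. K \<subseteq> N \<and> j \<in> N - K \<and> dot N r (residual \<Gamma> j K) = 0} \<union>
      {ci i j (insert n K) |i j K. K \<subseteq> N \<and> i \<in> N - K \<and> j \<in> N - K \<and> i \<noteq> j \<and>
        ci i j K \<in> ci_structure_of N \<Gamma> \<and> dot N r (residual \<Gamma> i K) = 0}"
    "dominant N \<Gamma> \<longrightarrow> (\<forall>K\<subseteq>N. \<forall>j\<in>N - K. \<bar>dot N r (residual \<Gamma> j K)\<bar> < pcov \<Gamma> j j K) \<longrightarrow>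
      dominant (insert n N) \<Gamma>'"
proof -
  let ?f = "\<lambda>j K. dot N r (residual \<Gamma> j K)" and ?p = "pcov \<Gamma>"
  \<comment> \<open>The summands serve, in order, dominance for pairs containing \<open>n\<close>,
    absence of cancellation given \<open>n\<close>, and dominance given \<open>n\<close>. Absolute
    values in the denominators keep every summand non-negative, so \<open>c\<close> bounds each one
    even without dominance.\<close>
  define bound where "bound i j K = \<bar>?f i K\<bar> + \<bar>?f i K * ?f j K\<bar> / \<bar>?p i j K\<bar>
    + (\<bar>?f i K * ?f j K\<bar> + ?f i K * ?f i K) / \<bar>?p i i K - \<bar>?p i j K\<bar>\<bar>" for i j K
  define c where "c = (\<Sum>(i, j, K)\<in>N \<times> N \<times> Pow N. bound i j K)"
  have bound_nonneg: "bound i j K \<ge> 0" for i j K by (simp add: bound_def)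
  have bound_le: "bound i j K \<le> c" if "i \<in> N" "j \<in> N" "K \<subseteq> N" for i j K
  proof -
    have "(case (i, j, K) of (i, j, K) \<Rightarrow> bound i j K) \<le> c" unfolding c_def
      by (rule member_le_sum) (use that finite_N bound_nonneg in auto)
    then show ?thesis by simp
  qed
  obtain \<Gamma>' where pp: "principally_positive (insert n N) \<Gamma>'"
    and eq: "\<forall>a\<in>N. \<forall>b\<in>N. \<Gamma>' a b = \<Gamma> a b" and row: "\<forall>b\<in>N. \<Gamma>' n b = r b"
    and large: "\<And>K. K \<subseteq> N \<Longrightarrow> pcov \<Gamma>' n n K > c"
    using ex_extension[OF n, of r c] by blast
  interpret E: positive_matrix "insert n N" \<Gamma>'
    using pp finite_N by unfold_locales auto
  note ext = pcov_extend[OF E.positive_matrix_axioms eq]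
  have dot_row: "dot N (\<Gamma>' n) w = dot N r w" for w
    unfolding dot_def by (rule sum.cong) (use row in auto)
  have q1: "pcov \<Gamma>' i j K = ?p i j K" if "K \<subseteq> N" "i \<in> N" "j \<in> N - K" for i j K
    using ext(2) that by blast
  have q2: "pcov \<Gamma>' n j K = ?f j K" if "K \<subseteq> N" "j \<in> N - K" for j K
    using ext(3)[OF that] by (simp add: dot_row)
  have q2': "pcov \<Gamma>' j n K = ?f j K" if "K \<subseteq> N" "j \<in> N - K" for j K
  proof -
    have "pcov \<Gamma>' j n K = pcov \<Gamma>' n j K" by (rule E.pcov_sym) (use that n in auto)
    then show ?thesis using q2[OF that] by simp
  qed
  have q3: "pcov \<Gamma>' i j (insert n K) = ?p i j K - ?f i K * ?f j K / pcov \<Gamma>' n n K"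
    if "K \<subseteq> N" "i \<in> N - K" "j \<in> N - K" for i j K
  proof -
    have "pcov \<Gamma>' i j (insert n K)
      = pcov \<Gamma>' i j K - pcov \<Gamma>' i n K * pcov \<Gamma>' n j K / pcov \<Gamma>' n n K"
      by (rule E.pcov_insert) (use that n in auto)
    then show ?thesis using q1[of K i j] q2[of K j] q2'[of K i] that by simp
  qed
  have P: "pcov \<Gamma>' n n K > 0" "pcov \<Gamma>' n n K > \<bar>?f i K\<bar>"
    "pcov \<Gamma>' n n K > \<bar>?f i K * ?f j K\<bar> / \<bar>?p i j K\<bar>"
    "pcov \<Gamma>' n n K > (\<bar>?f i K * ?f j K\<bar> + ?f i K * ?f i K) / \<bar>?p i i K - \<bar>?p i j K\<bar>\<bar>"
    if "K \<subseteq> N" "i \<in> N" "j \<in> N" for i j K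
  proof -
    have 1: "pcov \<Gamma>' n n K > bound i j K"
      using large[of K] bound_le[of i j K] that by simp
    have 2: "0 \<le> \<bar>?f i K\<bar>" "0 \<le> \<bar>?f i K * ?f j K\<bar> / \<bar>?p i j K\<bar>"
      "0 \<le> (\<bar>?f i K * ?f j K\<bar> + ?f i K * ?f i K) / \<bar>?p i i K - \<bar>?p i j K\<bar>\<bar>"
      by simp_all
    show "pcov \<Gamma>' n n K > 0" "pcov \<Gamma>' n n K > \<bar>?f i K\<bar>"
      "pcov \<Gamma>' n n K > \<bar>?f i K * ?f j K\<bar> / \<bar>?p i j K\<bar>"
      "pcov \<Gamma>' n n K > (\<bar>?f i K * ?f j K\<bar> + ?f i K * ?f i K) / \<bar>?p i i K - \<bar>?p i j K\<bar>\<bar>"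
      using 1 2 unfolding bound_def by linarith+
  qed
  have q3_zero: "pcov \<Gamma>' i j (insert n K) = 0 \<longleftrightarrow> ?p i j K = 0 \<and> (?f i K = 0 \<or> ?f j K = 0)"
    if "K \<subseteq> N" "i \<in> N - K" "j \<in> N - K" for i j K
    using large_denominator_eq_0_iff[OF P(1,3)[of K i j]] q3[OF that] that by simp
  let ?A = "{ci n j K |j K. K \<subseteq> N \<and> j \<in> N - K \<and> ?f j K = 0}"
  let ?B = "{ci i j (insert n K) |i j K. K \<subseteq> N \<and> i \<in> N - K \<and> j \<in> N - K \<and> i \<noteq> j \<and>
        ci i j K \<in> ci_structure_of N \<Gamma> \<and> ?f i K = 0}"
  have "s \<in> ci_structure_of N \<Gamma> \<union> ?A \<union> ?B" if s: "s \<in> ci_structure_of (insert n N) \<Gamma>'" for s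
  proof -
    obtain i j K where ijK: "s = ci i j K" "K \<subseteq> insert n N" "i \<in> insert n N - K"
      "j \<in> insert n N - K" "i \<noteq> j" "pcov \<Gamma>' i j K = 0"
      using E.ci_structureE[OF s] by metis
    consider "n \<in> K" | "n \<notin> K" "i = n" | "n \<notin> K" "j = n" | "n \<notin> K" "i \<noteq> n" "j \<noteq> n" by blast
    then show ?thesis
    proof cases
      case 1
      define J where "J = K - {n}"
      have J: "J \<subseteq> N" "i \<in> N - J" "j \<in> N - J" and K: "K = insert n J"
        using ijK 1 by (auto simp: J_def)
      have *: "?p i j J = 0" "?f i J = 0 \<or> ?f j J = 0"
        using ijK(6) q3_zero[OF J] unfolding K by auto
      then have "ci i j J \<in> ci_structure_of N \<Gamma>" "ci j i J \<in> ci_structure_of N \<Gamma>"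
        using ci_mem_iff'[OF J ijK(5)] ci_commute[of i j J] by auto
      \<comment> \<open>\<open>?B\<close> asks for vanishing at the first index of the pair only;
        swapping the pair covers the second.\<close>
      then have "s \<in> ?B" using * J ijK(5) ijK(1) ci_commute[of i j K] unfolding K by blast
      then show ?thesis by blast
    next
      case 2
      then have J: "K \<subseteq> N" "j \<in> N - K" using ijK by auto
      then have "?f j K = 0" using q2[of K j] ijK 2 by simp
      then have "s \<in> ?A" using J ijK(1) 2 by blast
      then show ?thesis by blast
    next
      case 3
      then have J: "K \<subseteq> N" "i \<in> N - K" using ijK by auto
      then have "?f i K = 0" using q2'[of K i] ijK 3 by simp
      then have "s \<in> ?A" using J ijK(1) 3 ci_commute[of i j K] by blast
      then show ?thesis by blast
    next
      case 4
      then have "K \<subseteq> N" "i \<in> N - K" "j \<in> N - K" using ijK by auto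
      then show ?thesis using ijK ci_mem_iff'[of K i j] q1[of K i j] by auto
    qed
  qed
  moreover have "s \<in> ci_structure_of (insert n N) \<Gamma>'" if s: "s \<in> ci_structure_of N \<Gamma>" for s
  proof -
    obtain i j K where ijK: "s = ci i j K" "K \<subseteq> N" "i \<in> N - K" "j \<in> N - K" "i \<noteq> j" "?p i j K = 0"
      using ci_structureE[OF s] by metis
    then show ?thesis using E.ci_mem_iff'[of K i j] q1[of K i j] n by auto
  qed
  moreover have "s \<in> ci_structure_of (insert n N) \<Gamma>'" if s: "s \<in> ?A" for s
  proof -
    obtain j K where ijK: "s = ci n j K" "K \<subseteq> N" "j \<in> N - K" "?f j K = 0"
      using s by blast
    then show ?thesis using E.ci_mem_iff'[of K n j] q2[of K j] n by auto
  qed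
  moreover have "s \<in> ci_structure_of (insert n N) \<Gamma>'" if s: "s \<in> ?B" for s
  proof -
    obtain i j K where ijK: "s = ci i j (insert n K)" "K \<subseteq> N" "i \<in> N - K" "j \<in> N - K" "i \<noteq> j"
      "ci i j K \<in> ci_structure_of N \<Gamma>" "?f i K = 0"
      using s by blast
    then have "?p i j K = 0" using ci_mem_iff'[of K i j] by blast
    then show ?thesis using E.ci_mem_iff'[of "insert n K" i j] q3_zero[of K i j] n ijK by auto
  qed
  ultimately have cis: "ci_structure_of (insert n N) \<Gamma>' = ci_structure_of N \<Gamma> \<union> ?A \<union> ?B" by blast
  have "dominant (insert n N) \<Gamma>'" if dom: "dominant N \<Gamma>"
    and small: "\<forall>K\<subseteq>N. \<forall>j\<in>N - K. \<bar>?f j K\<bar> < ?p j j K"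
    unfolding dominant_def
  proof (intro allI ballI impI)
    fix K i j
    assume ijK: "K \<subseteq> insert n N" "i \<in> insert n N - K" "j \<in> insert n N - K" "i \<noteq> j"
    consider "n \<in> K" | "n \<notin> K" "i = n" | "n \<notin> K" "j = n" | "n \<notin> K" "i \<noteq> n" "j \<noteq> n" by blast
    then show "\<bar>pcov \<Gamma>' i j K\<bar> < pcov \<Gamma>' i i K"
    proof cases
      case 1
      define J where "J = K - {n}"
      have J: "J \<subseteq> N" "i \<in> N - J" "j \<in> N - J" and K: "K = insert n J"
        using ijK 1 by (auto simp: J_def)
      have "\<bar>?p i j J\<bar> < ?p i i J" using dom J ijK(4) unfolding dominant_def by blast
      then show ?thesis
        using large_denominator_less[OF P(1) _ P(4), of J i j i j] J
        unfolding K q3[OF J] q3[OF J(1,2,2)] by blast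
    next
      case 2
      then have "K \<subseteq> N" "j \<in> N - K" using ijK by auto
      then show ?thesis using q2[of K j] P(2)[of K j j] \<open>i = n\<close> by simp
    next
      case 3
      then have "K \<subseteq> N" "i \<in> N - K" using ijK by auto
      then show ?thesis using q2'[of K i] q1[of K i i] small \<open>j = n\<close> by simp
    next
      case 4
      then have K: "K \<subseteq> N" "i \<in> N - K" "j \<in> N - K" using ijK by auto
      then show ?thesis using q1[of K i j] q1[of K i i] dom ijK(4) unfolding dominant_def by simp
    qed
  qed
  then show thesis by (intro that[OF pp cis] impI)
qed

section \<open>Linear dependence of residuals\<close>

context regular_matrix
begin

text \<open>Weaker than genericity, so that it also covers a matrix whose only statement is (kl|M),
  with \<open>j\<close> distinct from \<open>k\<close> and \<open>l\<close>.\<close>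

definition indep_free :: "'a \<Rightarrow> bool" where
  "indep_free j \<longleftrightarrow> (\<forall>K\<subseteq>N. \<forall>i\<in>N - K. i \<noteq> j \<longrightarrow> j \<notin> K \<longrightarrow> pcov \<Gamma> i j K \<noteq> 0)"

lemma indep_freeD:
  "indep_free j \<Longrightarrow> K \<subseteq> N \<Longrightarrow> i \<in> N - K \<Longrightarrow> i \<noteq> j \<Longrightarrow> j \<notin> K \<Longrightarrow> pcov \<Gamma> i j K \<noteq> 0"
  by (simp add: indep_free_def)

lemma residual_eq_0_iff:
  assumes free: "indep_free j" and K: "K \<subseteq> N" "j \<in> N - K" and m: "m \<in> N"
  shows "residual \<Gamma> j K m = 0 \<longleftrightarrow> m \<notin> insert j K"
proof (cases "m \<in> K")
  case True
  then have "pcov \<Gamma> m j (K - {m}) \<noteq> 0"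
    by (intro indep_freeD[OF free]) (use K m in auto)
  moreover have "pcov \<Gamma> m m (K - {m}) \<noteq> 0"
    by (rule pcov_nz) (use K m in auto)
  ultimately show ?thesis using True residual_inside[OF K True] by simp
next
  case False
  then show ?thesis using K residual_outside[of K j m] by (cases "m = j") auto
qed

lemma pcov_eq_0_iff:
  assumes free: "indep_free j" and K: "K \<subseteq> N" "j \<in> N - K" and m: "m \<in> N"
  shows "pcov \<Gamma> m j K = 0 \<longleftrightarrow> m \<in> K"
proof (cases "m = j")
  case True
  then show ?thesis using pcov_nz[OF K] K by auto
next
  case False
  then show ?thesis
    using indep_freeD[OF free K(1), of m] pcov_inside[of K j m] K m by (cases "m \<in> K") auto
qed

text \<open>Only the residuals of \<open>j\<close> are controlled, so each comparison gives one
  inclusion: supports give \<open>insert j K \<subseteq> insert a C\<close>, orthogonalities give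
  \<open>C \<subseteq> K\<close>. Together they force equality.\<close>

lemma residual_proportional:
  assumes free: "indep_free j" and jK: "K \<subseteq> N" "j \<in> N - K" and aC: "C \<subseteq> N" "a \<in> N - C"
    and eq: "\<And>m. m \<in> N \<Longrightarrow> residual \<Gamma> a C m = \<alpha> * residual \<Gamma> j K m"
  shows "a = j \<and> C = K"
proof -
  have nz: "\<alpha> \<noteq> 0" using eq[of a] aC by auto
  have "insert j K \<subseteq> insert a C"
  proof
    fix m assume m: "m \<in> insert j K"
    then have "m \<in> N" "residual \<Gamma> j K m \<noteq> 0" using jK residual_eq_0_iff[OF free jK, of m] by auto
    then show "m \<in> insert a C"
      using eq[of m] nz residual_outside[of C a m] aC by auto
  qed
  moreover have "C \<subseteq> K"
  proof
    fix m assume m: "m \<in> C"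
    have "app \<Gamma> N (residual \<Gamma> a C) m = \<alpha> * app \<Gamma> N (residual \<Gamma> j K) m"
      using eq by (simp add: app_def sum_distrib_left mult_ac)
    then have "pcov \<Gamma> a a C \<noteq> 0 \<and> pcov \<Gamma> m a C = \<alpha> * pcov \<Gamma> m j K"
      using aC jK pcov_nz by (simp add: pcov_conv_app)
    then have "pcov \<Gamma> m j K = 0" using pcov_inside[of C a m] aC m nz by auto
    then show "m \<in> K" using pcov_eq_0_iff[OF free jK, of m] m aC by auto
  qed
  ultimately show ?thesis using jK aC by auto
qed

end

text \<open>With \<open>i\<close> in front, any two of these statements that do not differ in the conditioning set alone
  imply all four by the first two gaussoid axioms.\<close>

definition quad :: "'a \<Rightarrow> 'a \<Rightarrow> 'a set \<Rightarrow> ('a \<times> 'a set) set" where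
  "quad x y I = {(x, I), (y, I), (x, insert y I), (y, insert x I)}"

locale generic_matrix = positive_matrix N \<Gamma>
  for N :: "'a set" and \<Gamma> :: "'a \<Rightarrow> 'a \<Rightarrow> 'k::linordered_field" +
  assumes empty: "ci_structure_of N \<Gamma> = {}" and dom: "dominant N \<Gamma>"
begin

lemma indep_free: "j \<in> N \<Longrightarrow> indep_free j"
  unfolding indep_free_def using ci_mem_iff' empty by blast

lemma residual_less_1:
  assumes "K \<subseteq> N" "j \<in> N - K" "m \<in> N" "m \<noteq> j"
  shows "\<bar>residual \<Gamma> j K m\<bar> < 1"
proof (cases "m \<in> K")
  case True
  let ?J = "K - {m}"
  have "\<bar>pcov \<Gamma> m j ?J\<bar> < pcov \<Gamma> m m ?J"
    using dom assms True unfolding dominant_def by blast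
  then show ?thesis
    using residual_inside[of K j m] assms True by simp
next
  case False
  then show ?thesis using residual_outside[of K j m] assms by simp
qed

lemma eq_or_insert:
  assumes "\<And>m. m \<in> X - {y} \<longleftrightarrow> m \<in> I"
  shows "X = I \<or> X = insert y I"
  using assms by blast

text \<open>Since supports and zeros of all residuals are known, no index lies in exactly one of the sets
  \<open>insert j K\<close>, \<open>insert l M\<close>, \<open>insert a C\<close>, nor in exactly two of \<open>K\<close>, \<open>M\<close>, \<open>C\<close>. If \<open>j\<close>, \<open>l\<close>, \<open>a\<close> were distinct,
  then each of these three coordinates would make one coefficient of the relation smaller in
  absolute value than another, by dominance.\<close>

lemma residual_dependent:
  assumes jK: "K \<subseteq> N" "j \<in> N - K" and lM: "M \<subseteq> N" "l \<in> N - M" and aC: "C \<subseteq> N" "a \<in> N - C"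
    and eq: "\<And>m. m \<in> N \<Longrightarrow> residual \<Gamma> a C m = \<alpha> * residual \<Gamma> j K m + \<beta> * residual \<Gamma> l M m"
  shows "(a, C) = (j, K) \<or> (a, C) = (l, M) \<or>
    (j, K) \<noteq> (l, M) \<and> (\<exists>x y I. x \<in> N \<and> y \<in> N \<and> x \<noteq> y \<and> I \<subseteq> N - {x, y} \<and>
      {(j, K), (l, M), (a, C)} \<subseteq> quad x y I)"
proof -
  consider "\<alpha> = 0" | "\<beta> = 0" | "(j, K) = (l, M)" | "\<alpha> \<noteq> 0" "\<beta> \<noteq> 0" "(j, K) \<noteq> (l, M)" by blast
  then show ?thesis
  proof cases
    case 1
    then show ?thesis
      using residual_proportional[OF indep_free lM aC, of \<beta>] lM eq by auto
  next
    case 2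
    then show ?thesis
      using residual_proportional[OF indep_free jK aC, of \<alpha>] jK eq by auto
  next
    case 3
    then have "residual \<Gamma> a C m = (\<alpha> + \<beta>) * residual \<Gamma> j K m" if "m \<in> N" for m
      using eq[OF that] by (simp add: algebra_simps)
    then show ?thesis
      using residual_proportional[OF indep_free jK aC, of "\<alpha> + \<beta>"] jK by auto
  next
    case 4
    have quad: ?thesis if "x \<in> N" "y \<in> N" "x \<noteq> y" "I \<subseteq> N - {x, y}"
      "{(j, K), (l, M), (a, C)} \<subseteq> quad x y I" for x y I
      using that 4(3) by blast
    have N: "j \<in> N" "l \<in> N" "a \<in> N" and notin: "j \<notin> K" "l \<notin> M" "a \<notin> C"
      using jK lM aC by auto
    have r0: "residual \<Gamma> j K m = 0 \<longleftrightarrow> m \<notin> insert j K" "residual \<Gamma> l M m = 0 \<longleftrightarrow> m \<notin> insert l M"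
      "residual \<Gamma> a C m = 0 \<longleftrightarrow> m \<notin> insert a C" if "m \<in> N" for m
      using residual_eq_0_iff[OF indep_free] jK lM aC N that by blast+
    have p0: "pcov \<Gamma> m j K = 0 \<longleftrightarrow> m \<in> K" "pcov \<Gamma> m l M = 0 \<longleftrightarrow> m \<in> M"
      "pcov \<Gamma> m a C = 0 \<longleftrightarrow> m \<in> C" if "m \<in> N" for m
      using pcov_eq_0_iff[OF indep_free] jK lM aC N that by blast+
    have "app \<Gamma> N (residual \<Gamma> a C) m
        = \<alpha> * app \<Gamma> N (residual \<Gamma> j K) m + \<beta> * app \<Gamma> N (residual \<Gamma> l M) m" for m
      unfolding app_linear[symmetric] by (rule app_cong) (use eq in auto)
    then have peq: "pcov \<Gamma> m a C = \<alpha> * pcov \<Gamma> m j K + \<beta> * pcov \<Gamma> m l M" for m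
      using jK lM aC by (simp add: pcov_conv_app)
    have one: "m \<in> insert a C \<Longrightarrow> m \<in> insert j K \<or> m \<in> insert l M"
      "m \<in> insert j K \<Longrightarrow> m \<in> insert a C \<or> m \<in> insert l M"
      "m \<in> insert l M \<Longrightarrow> m \<in> insert a C \<or> m \<in> insert j K" if "m \<in> N" for m
      using r0[OF that] eq[OF that] 4 by fastforce+
    have two: "m \<in> K \<Longrightarrow> m \<in> M \<Longrightarrow> m \<in> C" "m \<in> K \<Longrightarrow> m \<in> C \<Longrightarrow> m \<in> M"
      "m \<in> M \<Longrightarrow> m \<in> C \<Longrightarrow> m \<in> K" if "m \<in> N" for m
      using p0[OF that] peq[of m] 4 by auto
    have same: "(m \<in> K \<longleftrightarrow> m \<in> M) \<and> (m \<in> K \<longleftrightarrow> m \<in> C)" if "m \<noteq> j" "m \<noteq> l" "m \<noteq> a" for m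
    proof (cases "m \<in> N")
      case True
      then show ?thesis using one[OF True] two[OF True] that by blast
    next
      case False
      then show ?thesis using jK lM aC by blast
    qed
    have False if "j \<noteq> l" "j \<noteq> a" "l \<noteq> a"
    proof -
      \<comment> \<open>As \<open>j \<notin> K\<close>, \<open>two\<close> shows that
        \<open>j\<close> is not in both \<open>M\<close> and \<open>C\<close>; likewise for
        \<open>l\<close> and \<open>a\<close>.\<close>
      have r: "residual \<Gamma> l M j = 0 \<or> residual \<Gamma> a C j = 0"
        "residual \<Gamma> j K l = 0 \<or> residual \<Gamma> a C l = 0"
        "residual \<Gamma> j K a = 0 \<or> residual \<Gamma> l M a = 0"
        using r0[OF N(1)] r0[OF N(2)] r0[OF N(3)] two[OF N(1)] two[OF N(2)] two[OF N(3)] notin that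
        by auto
      have b: "\<bar>residual \<Gamma> l M j\<bar> < 1" "\<bar>residual \<Gamma> a C j\<bar> < 1" "\<bar>residual \<Gamma> j K l\<bar> < 1"
        "\<bar>residual \<Gamma> a C l\<bar> < 1" "\<bar>residual \<Gamma> j K a\<bar> < 1" "\<bar>residual \<Gamma> l M a\<bar> < 1"
        using residual_less_1 jK lM aC that by auto
      have small: "\<bar>x * y\<bar> < \<bar>x\<bar>" if "\<bar>y\<bar> < 1" "x \<noteq> 0" for x y :: 'k
        using that by (simp add: abs_mult)
      have e: "residual \<Gamma> a C j = \<alpha> + \<beta> * residual \<Gamma> l M j"
        "residual \<Gamma> a C l = \<alpha> * residual \<Gamma> j K l + \<beta>"
        "1 = \<alpha> * residual \<Gamma> j K a + \<beta> * residual \<Gamma> l M a"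
        using eq[OF N(1)] eq[OF N(2)] eq[OF N(3)] jK lM aC by simp_all
      have s: "\<bar>\<beta> * residual \<Gamma> l M j\<bar> < \<bar>\<beta>\<bar>" "\<bar>\<alpha> * residual \<Gamma> j K l\<bar> < \<bar>\<alpha>\<bar>"
        "\<bar>\<alpha> * residual \<Gamma> j K a\<bar> < \<bar>\<alpha>\<bar>" "\<bar>\<beta> * residual \<Gamma> l M a\<bar> < \<bar>\<beta>\<bar>"
        using small b 4 by blast+
      \<comment> \<open>The three coordinates show in turn that none of \<bar>\<alpha>\<bar>,
        \<bar>\<beta>\<bar>, 1 is a maximum of the three.\<close>
      have "\<bar>\<alpha>\<bar> < \<bar>\<beta>\<bar> \<or> \<bar>\<alpha>\<bar> < 1" using e(1) r(1) s(1) b(2) by (auto simp: abs_if split: if_splits)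
      moreover have "\<bar>\<beta>\<bar> < \<bar>\<alpha>\<bar> \<or> \<bar>\<beta>\<bar> < 1"
        using e(2) r(2) s(2) b(4) by (auto simp: abs_if split: if_splits)
      moreover have "1 < \<bar>\<alpha>\<bar> \<or> 1 < \<bar>\<beta>\<bar>"
        using e(3) r(3) s(3,4) by (auto simp: abs_if split: if_splits)
      ultimately show False by linarith
    qed
    \<comment> \<open>If all three heads agree, \<open>same\<close> gives \<open>C = K\<close>. If
      two heads remain, the conditioning sets agree outside them, which puts the three pairs into
      one \<open>quad\<close>.\<close>
    then consider "j = l" "l = a" | "j = l" "j \<noteq> a" | "j = a" "j \<noteq> l" | "l = a" "j \<noteq> a" by blast
    then show ?thesis
    proof cases
      case 1
      have "m \<in> C \<longleftrightarrow> m \<in> K" for m using same[of m] notin 1 by auto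
      then have "C = K" by (simp add: set_eq_iff)
      then show ?thesis using 1 by simp
    next
      case 2
      define I where "I = C - {j}"
      have kI: "m \<in> K - {a} \<longleftrightarrow> m \<in> I" for m
        using same[of m] notin 2 by (auto simp: I_def)
      have mI: "m \<in> M - {a} \<longleftrightarrow> m \<in> I" for m
        using same[of m] notin 2 by (auto simp: I_def)
      have cI: "m \<in> C - {j} \<longleftrightarrow> m \<in> I" for m
        using same[of m] notin 2 by (auto simp: I_def)
      have s: "{(j, K), (l, M), (a, C)} \<subseteq> quad j a I"
        using 2 eq_or_insert[OF kI] eq_or_insert[OF mI] eq_or_insert[OF cI]
        unfolding quad_def by auto
      have i: "I \<subseteq> N - {j, a}" unfolding I_def using notin aC lM jK by auto
      show ?thesis by (rule quad[OF N(1) N(3) 2(2) i s])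
    next
      case 3
      define I where "I = M - {j}"
      have kI: "m \<in> K - {l} \<longleftrightarrow> m \<in> I" for m
        using same[of m] notin 3 by (auto simp: I_def)
      have cI: "m \<in> C - {l} \<longleftrightarrow> m \<in> I" for m
        using same[of m] notin 3 by (auto simp: I_def)
      have mI: "m \<in> M - {j} \<longleftrightarrow> m \<in> I" for m
        using same[of m] notin 3 by (auto simp: I_def)
      have s: "{(j, K), (l, M), (a, C)} \<subseteq> quad j l I"
        using 3 eq_or_insert[OF kI] eq_or_insert[OF mI] eq_or_insert[OF cI]
        unfolding quad_def by auto
      have i: "I \<subseteq> N - {j, l}" unfolding I_def using notin aC lM jK by auto
      show ?thesis by (rule quad[OF N(1,2) 3(2) i s])
    next
      case 4
      have jl: "l \<noteq> j" using 4 by simp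
      define I where "I = K - {l}"
      have mI: "m \<in> M - {j} \<longleftrightarrow> m \<in> I" for m
        using same[of m] notin 4 by (auto simp: I_def)
      have cI: "m \<in> C - {j} \<longleftrightarrow> m \<in> I" for m
        using same[of m] notin 4 by (auto simp: I_def)
      have kI: "m \<in> K - {l} \<longleftrightarrow> m \<in> I" for m
        using same[of m] notin 4 by (auto simp: I_def)
      have s: "{(j, K), (l, M), (a, C)} \<subseteq> quad l j I"
        using 4 eq_or_insert[OF kI] eq_or_insert[OF mI] eq_or_insert[OF cI]
        unfolding quad_def by auto
      have i: "I \<subseteq> N - {l, j}" unfolding I_def using notin aC lM jK by auto
      show ?thesis by (rule quad[OF N(2,1) jl i s])
    qed
  qed
qed

end

section \<open>Realizing one and two statements\<close>

lemma dot_scale: "dot N (\<lambda>m. t * r m) w = t * dot N r w"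
  by (simp add: dot_def sum_distrib_left mult.assoc)

lemma finite_residuals:
  assumes "finite N"
  shows "finite {residual \<Gamma> j K |j K. K \<subseteq> N \<and> j \<in> N - K \<and> P j K}"
proof (rule finite_subset)
  show "{residual \<Gamma> j K |j K. K \<subseteq> N \<and> j \<in> N - K \<and> P j K} \<subseteq> (\<lambda>(j, K). residual \<Gamma> j K) ` (N \<times> Pow N)"
    by auto
qed (use assms in simp)

lemma ex_generic:
  assumes "finite N"
  shows "\<exists>\<Gamma> :: 'a \<Rightarrow> 'a \<Rightarrow> 'k::linordered_field. generic_matrix N \<Gamma>"
  using assms
proof (induction N rule: finite_induct)
  case empty
  have "generic_matrix {} (\<lambda>_ _ :: 'a. 0 :: 'k)"
    by unfold_locales
      (auto simp: principally_positive_def symmetric_on_def minor_empty ci_structure_of_def dominant_def)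
  then show ?case by blast
next
  case (insert n N)
  then obtain \<Gamma> :: "'a \<Rightarrow> 'a \<Rightarrow> 'k" where "generic_matrix N \<Gamma>" by blast
  then interpret generic_matrix N \<Gamma> .
  define F where "F = {residual \<Gamma> j K |j K. K \<subseteq> N \<and> j \<in> N - K \<and> True}"
  have F: "finite F" unfolding F_def by (rule finite_residuals[OF insert.hyps(1)])
  have "\<exists>m\<in>N. f m \<noteq> \<alpha> * 0 + \<beta> * 0" if f: "f \<in> F" for f and \<alpha> \<beta> :: 'k
  proof -
    obtain j K where "f = residual \<Gamma> j K" "K \<subseteq> N" "j \<in> N - K" using f unfolding F_def by blast
    then show ?thesis by (intro bexI[of _ j]) auto
  qed
  from generic_row[where w = "\<lambda>_. 0" and w' = "\<lambda>_. 0",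
      OF insert.hyps(1) F this]
  obtain r where r: "\<And>f. f \<in> F \<Longrightarrow> dot N r f \<noteq> 0" by blast
  have nz: "dot N r (residual \<Gamma> j K) \<noteq> 0" if "K \<subseteq> N" "j \<in> N - K" for j K
    by (rule r) (use that F_def in blast)
  let ?g = "\<lambda>j K. \<bar>dot N r (residual \<Gamma> j K)\<bar> / \<bar>pcov \<Gamma> j j K\<bar>"
  define S where "S = (\<Sum>(j, K)\<in>N \<times> Pow N. ?g j K)"
  \<comment> \<open>Scaling keeps all pairings non-zero, and \<open>1 + S\<close> exceeds every
    ratio that dominance has to bring below 1.\<close>
  define t where "t = 1 / (1 + S)"
  have S: "S \<ge> 0" unfolding S_def by (rule sum_nonneg) auto
  then have t: "t > 0" by (simp add: t_def)
  let ?r = "\<lambda>m. t * r m"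
  have small: "\<bar>dot N ?r (residual \<Gamma> j K)\<bar> < pcov \<Gamma> j j K" if "K \<subseteq> N" "j \<in> N - K" for j K
  proof -
    have "(case (j, K) of (j, K) \<Rightarrow> ?g j K) \<le> S"
      unfolding S_def by (rule member_le_sum) (use that insert.hyps in auto)
    then have "\<bar>dot N r (residual \<Gamma> j K)\<bar> \<le> S * pcov \<Gamma> j j K"
      using pcov_pos[OF that] by (simp add: pos_divide_le_eq)
    also have "\<dots> < (1 + S) * pcov \<Gamma> j j K"
      using pcov_pos[OF that] by (simp add: algebra_simps)
    finally have "t * \<bar>dot N r (residual \<Gamma> j K)\<bar> < t * ((1 + S) * pcov \<Gamma> j j K)"
      by (rule mult_strict_left_mono) (rule t)
    also have "\<dots> = pcov \<Gamma> j j K" using S by (simp add: t_def)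
    finally show ?thesis using t unfolding dot_scale abs_mult by simp
  qed
  obtain \<Gamma>' :: "'a \<Rightarrow> 'a \<Rightarrow> 'k" where \<Gamma>': "principally_positive (insert n N) \<Gamma>'"
    "ci_structure_of (insert n N) \<Gamma>' = ci_structure_of N \<Gamma> \<union>
      {ci n j K |j K. K \<subseteq> N \<and> j \<in> N - K \<and> dot N ?r (residual \<Gamma> j K) = 0} \<union>
      {ci i j (insert n K) |i j K. K \<subseteq> N \<and> i \<in> N - K \<and> j \<in> N - K \<and> i \<noteq> j \<and>
        ci i j K \<in> ci_structure_of N \<Gamma> \<and> dot N ?r (residual \<Gamma> i K) = 0}"
    "dominant N \<Gamma> \<longrightarrow> (\<forall>K\<subseteq>N. \<forall>j\<in>N - K. \<bar>dot N ?r (residual \<Gamma> j K)\<bar> < pcov \<Gamma> j j K) \<longrightarrow>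
      dominant (insert n N) \<Gamma>'"
    by (rule extension[OF insert.hyps(2), of ?r])
  have "dominant (insert n N) \<Gamma>'" using \<Gamma>'(3) dom small by blast
  moreover have "ci_structure_of (insert n N) \<Gamma>' = {}"
    unfolding \<Gamma>'(2) empty using nz t by (auto simp: dot_scale)
  ultimately have "generic_matrix (insert n N) \<Gamma>'"
    using \<Gamma>'(1) insert.hyps by unfold_locales auto
  then show ?case by blast
qed

lemma ex_two_common:
  assumes N: "finite N" "i \<in> N" and j: "j \<in> N - {i}" "K \<subseteq> N - {i, j}"
    and l: "l \<in> N - {i}" "M \<subseteq> N - {i, l}"
  shows "\<exists>\<Gamma> :: 'a \<Rightarrow> 'a \<Rightarrow> 'k::linordered_field. principally_positive N \<Gamma> \<and>
    ci i j K \<in> ci_structure_of N \<Gamma> \<and> ci i l M \<in> ci_structure_of N \<Gamma> \<and>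
    (\<forall>s\<in>ci_structure_of N \<Gamma>. s = ci i j K \<or> s = ci i l M \<or>
      (j, K) \<noteq> (l, M) \<and> (\<exists>x y I a C. x \<in> N - {i} \<and> y \<in> N - {i} \<and> x \<noteq> y \<and> I \<subseteq> N - {i, x, y} \<and>
        s = ci i a C \<and> {(j, K), (l, M), (a, C)} \<subseteq> quad x y I))"
proof -
  define N0 where "N0 = N - {i}"
  have N0: "finite N0" "i \<notin> N0" "insert i N0 = N" using N by (auto simp: N0_def)
  obtain \<Gamma> :: "'a \<Rightarrow> 'a \<Rightarrow> 'k" where "generic_matrix N0 \<Gamma>" using ex_generic[OF N0(1)] by blast
  then interpret generic_matrix N0 \<Gamma> .
  have jK: "K \<subseteq> N0" "j \<in> N0 - K" and lM: "M \<subseteq> N0" "l \<in> N0 - M"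
    using j l by (auto simp: N0_def)
  let ?R = "residual \<Gamma>"
  let ?P = "\<lambda>a C. \<forall>\<alpha> \<beta>. \<exists>m\<in>N0. ?R a C m \<noteq> \<alpha> * ?R j K m + \<beta> * ?R l M m"
  define F where "F = {?R a C |a C. C \<subseteq> N0 \<and> a \<in> N0 - C \<and> ?P a C}"
  have F: "finite F" unfolding F_def by (rule finite_residuals[OF N0(1)])
  have "\<exists>m\<in>N0. f m \<noteq> \<alpha> * ?R j K m + \<beta> * ?R l M m" if "f \<in> F" for f \<alpha> \<beta>
    using that unfolding F_def by blast
  from generic_row[where w = "?R j K" and w' = "?R l M", OF N0(1) F this]
  obtain r where r: "dot N0 r (?R j K) = 0" "dot N0 r (?R l M) = 0"
    "\<And>f. f \<in> F \<Longrightarrow> dot N0 r f \<noteq> 0" by blast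
  obtain \<Gamma>' :: "'a \<Rightarrow> 'a \<Rightarrow> 'k" where \<Gamma>': "principally_positive (insert i N0) \<Gamma>'"
    "ci_structure_of (insert i N0) \<Gamma>' = ci_structure_of N0 \<Gamma> \<union>
      {ci i j K |j K. K \<subseteq> N0 \<and> j \<in> N0 - K \<and> dot N0 r (residual \<Gamma> j K) = 0} \<union>
      {ci ia j (insert i K) |ia j K. K \<subseteq> N0 \<and> ia \<in> N0 - K \<and> j \<in> N0 - K \<and> ia \<noteq> j \<and>
        ci ia j K \<in> ci_structure_of N0 \<Gamma> \<and> dot N0 r (residual \<Gamma> ia K) = 0}"
    by (rule extension[OF N0(2), of r])
  \<comment> \<open>The old block has no statements, so none conditioned on \<open>i\<close> arise
    either; only pairs containing \<open>i\<close> remain.\<close>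
  have S: "ci_structure_of N \<Gamma>'
    = {ci i a C |a C. C \<subseteq> N0 \<and> a \<in> N0 - C \<and> dot N0 r (?R a C) = 0}"
    using \<Gamma>'(2) unfolding empty N0(3) by simp
  have "s = ci i j K \<or> s = ci i l M \<or>
      (j, K) \<noteq> (l, M) \<and> (\<exists>x y I a C. x \<in> N - {i} \<and> y \<in> N - {i} \<and> x \<noteq> y \<and> I \<subseteq> N - {i, x, y} \<and>
        s = ci i a C \<and> {(j, K), (l, M), (a, C)} \<subseteq> quad x y I)"
    if s: "s \<in> ci_structure_of N \<Gamma>'" for s
  proof -
    obtain a C where aC: "s = ci i a C" "C \<subseteq> N0" "a \<in> N0 - C" "dot N0 r (?R a C) = 0"
      using s unfolding S by blast
    have "\<not> ?P a C"
    proof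
      assume "?P a C"
      then have "?R a C \<in> F" unfolding F_def using aC by blast
      then show False using r(3) aC(4) by blast
    qed
    then obtain \<alpha> \<beta> where "\<And>m. m \<in> N0 \<Longrightarrow> ?R a C m = \<alpha> * ?R j K m + \<beta> * ?R l M m" by blast
    from residual_dependent[OF jK lM aC(2,3) this]
    consider "(a, C) = (j, K)" | "(a, C) = (l, M)" |
      x y I where "(j, K) \<noteq> (l, M)" "x \<in> N0" "y \<in> N0" "x \<noteq> y" "I \<subseteq> N0 - {x, y}"
        "{(j, K), (l, M), (a, C)} \<subseteq> quad x y I"
      by blast
    then show ?thesis
    proof cases
      case 3
      have "I \<subseteq> N - {i, x, y}" using 3(5) by (auto simp: N0_def)
      then show ?thesis using 3 aC(1) unfolding N0_def by blast
    qed (use aC in auto)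
  qed
  moreover have "ci i j K \<in> ci_structure_of N \<Gamma>'" "ci i l M \<in> ci_structure_of N \<Gamma>'"
    unfolding S using jK lM r by blast+
  ultimately show ?thesis using \<Gamma>'(1) unfolding N0(3) by blast
qed

text \<open>Prescribing the same statement twice rules out the \<open>quad\<close>
  alternative.\<close>

lemma ex_single:
  assumes "finite N" "i \<in> N" "j \<in> N - {i}" "K \<subseteq> N - {i, j}"
  shows "\<exists>\<Gamma> :: 'a \<Rightarrow> 'a \<Rightarrow> 'k::linordered_field. principally_positive N \<Gamma> \<and>
    ci_structure_of N \<Gamma> = {ci i j K}"
proof -
  obtain \<Gamma> :: "'a \<Rightarrow> 'a \<Rightarrow> 'k" where "principally_positive N \<Gamma>" "ci i j K \<in> ci_structure_of N \<Gamma>"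
    "\<forall>s\<in>ci_structure_of N \<Gamma>. s = ci i j K"
    using ex_two_common[OF assms assms(3,4)] by blast
  then show ?thesis by blast
qed

text \<open>As \<open>j\<close> is in no pair of the old structure, the residual of \<open>j\<close>
  given \<open>K\<close> is proportional to no other residual, and the row avoids all others. In
  particular it avoids those of \<open>k\<close> and \<open>l\<close> given \<open>M\<close>, so
  (kl|M) does not spread to (kl|iM).\<close>

lemma ex_two_disjoint_asym:
  assumes N: "finite N" "i \<in> N" "j \<in> N" "k \<in> N" "l \<in> N" "distinct [i, j, k, l]"
    and K: "K \<subseteq> N - {i, j}" and M: "M \<subseteq> N - {k, l}" "i \<notin> M"
  shows "\<exists>\<Gamma> :: 'a \<Rightarrow> 'a \<Rightarrow> 'k::linordered_field. principally_positive N \<Gamma> \<and>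
    ci_structure_of N \<Gamma> = {ci i j K, ci k l M}"
proof -
  define N0 where "N0 = N - {i}"
  have N0: "finite N0" "i \<notin> N0" "insert i N0 = N" using N by (auto simp: N0_def)
  have "k \<in> N0" "l \<in> N0 - {k}" "M \<subseteq> N0 - {k, l}" using N M by (auto simp: N0_def)
  from ex_single[OF N0(1) this]
  obtain \<Gamma> :: "'a \<Rightarrow> 'a \<Rightarrow> 'k" where \<Gamma>: "principally_positive N0 \<Gamma>" "ci_structure_of N0 \<Gamma> = {ci k l M}"
    by blast
  interpret positive_matrix N0 \<Gamma> by unfold_locales (use N0 \<Gamma> in auto)
  have jK: "K \<subseteq> N0" "j \<in> N0 - K" using N K by (auto simp: N0_def)
  have free: "indep_free j"
    unfolding indep_free_def
  proof (intro allI ballI impI notI)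
    fix K' i' assume *: "K' \<subseteq> N0" "i' \<in> N0 - K'" "i' \<noteq> j" "j \<notin> K'" "pcov \<Gamma> i' j K' = 0"
    then have "ci i' j K' = ci k l M" using ci_mem_iff'[of K' i' j] jK \<Gamma>(2) by auto
    then show False using N by (auto simp: ci_eq_iff)
  qed
  let ?R = "residual \<Gamma>"
  define F where "F = {?R a C |a C. C \<subseteq> N0 \<and> a \<in> N0 - C \<and> (a, C) \<noteq> (j, K)}"
  have F: "finite F" unfolding F_def by (rule finite_residuals[OF N0(1)])
  have "\<exists>m\<in>N0. f m \<noteq> \<alpha> * ?R j K m + \<beta> * ?R j K m" if f: "f \<in> F" for f \<alpha> \<beta>
  proof -
    obtain a C where aC: "f = ?R a C" "C \<subseteq> N0" "a \<in> N0 - C" "(a, C) \<noteq> (j, K)" using f unfolding F_def by blast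
    then have "\<exists>m\<in>N0. ?R a C m \<noteq> (\<alpha> + \<beta>) * ?R j K m"
      using residual_proportional[OF free jK aC(2,3), of "\<alpha> + \<beta>"] by blast
    then show ?thesis unfolding aC(1) by (simp add: algebra_simps)
  qed
  from generic_row[where w = "?R j K" and w' = "?R j K", OF N0(1) F this]
  obtain r where r: "dot N0 r (?R j K) = 0" "\<And>f. f \<in> F \<Longrightarrow> dot N0 r f \<noteq> 0" by blast
  have r_iff: "dot N0 r (?R a C) = 0 \<longleftrightarrow> a = j \<and> C = K" if "C \<subseteq> N0" "a \<in> N0 - C" for a C
    using r that unfolding F_def by blast
  obtain \<Gamma>' :: "'a \<Rightarrow> 'a \<Rightarrow> 'k" where \<Gamma>': "principally_positive (insert i N0) \<Gamma>'"
    "ci_structure_of (insert i N0) \<Gamma>' = ci_structure_of N0 \<Gamma> \<union>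
      {ci i j K |j K. K \<subseteq> N0 \<and> j \<in> N0 - K \<and> dot N0 r (residual \<Gamma> j K) = 0} \<union>
      {ci ia j (insert i K) |ia j K. K \<subseteq> N0 \<and> ia \<in> N0 - K \<and> j \<in> N0 - K \<and> ia \<noteq> j \<and>
        ci ia j K \<in> ci_structure_of N0 \<Gamma> \<and> dot N0 r (residual \<Gamma> ia K) = 0}"
    by (rule extension[OF N0(2), of r])
  have A: "{ci i j K |j K. K \<subseteq> N0 \<and> j \<in> N0 - K \<and> dot N0 r (residual \<Gamma> j K) = 0} = {ci i j K}"
    using r_iff jK by blast
  have B: "{ci ia j (insert i K) |ia j K. K \<subseteq> N0 \<and> ia \<in> N0 - K \<and> j \<in> N0 - K \<and> ia \<noteq> j \<and>
        ci ia j K \<in> ci_structure_of N0 \<Gamma> \<and> dot N0 r (residual \<Gamma> ia K) = 0} = {}"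
  proof -
    have False if "C \<subseteq> N0" "a \<in> N0 - C" "ci a b C \<in> ci_structure_of N0 \<Gamma>" "dot N0 r (?R a C) = 0"
      for a b C
      using that r_iff[of C a] \<Gamma>(2) N by (auto simp: ci_eq_iff)
    then show ?thesis by blast
  qed
  have "ci_structure_of N \<Gamma>' = {ci i j K, ci k l M}"
    using \<Gamma>'(2)[unfolded A B] unfolding \<Gamma>(2) N0(3) by auto
  then show ?thesis using \<Gamma>'(1) unfolding N0(3) by blast
qed

text \<open>The inverse matrix: if \<open>w\<close> is the residual of \<open>j\<close> outside \<open>insert j K\<close>, then \<open>\<Gamma> w\<close> is supported on
  \<open>insert j K\<close> and is, up to scale, the residual of \<open>j\<close> on \<open>K\<close> for \<open>\<Gamma>\<^sup>-\<^sup>1\<close>.\<close>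

lemma (in positive_matrix) ex_dual:
  "\<exists>\<Gamma>' :: 'a \<Rightarrow> 'a \<Rightarrow> 'k. principally_positive N \<Gamma>' \<and>
    (\<forall>K\<subseteq>N. \<forall>i\<in>N - K. \<forall>j\<in>N - K. i \<noteq> j \<longrightarrow>
      (ci i j K \<in> ci_structure_of N \<Gamma>' \<longleftrightarrow> ci i j (N - insert i (insert j K)) \<in> ci_structure_of N \<Gamma>))"
proof -
  let ?q = "\<lambda>j. pcov \<Gamma> j j (N - {j})"
  \<comment> \<open>Column \<open>j\<close> is the residual of \<open>j\<close> given all other
    indices over its partial variance, so \<Gamma> maps it to a unit vector.\<close>
  define \<Gamma>' where "\<Gamma>' m j = residual \<Gamma> j (N - {j}) m / ?q j" for m j
  have col: "app \<Gamma> N (\<lambda>m. \<Gamma>' m j) k = (if k = j then 1 else 0)" if "j \<in> N" "k \<in> N" for j k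
  proof -
    have "app \<Gamma> N (\<lambda>m. \<Gamma>' m j) k = pcov \<Gamma> k j (N - {j}) / ?q j"
      using that by (simp add: pcov_conv_app \<Gamma>'_def app_def sum_divide_distrib)
    then show ?thesis using that pcov_inside[of "N - {j}" j k] pcov_nz[of "N - {j}" j] by auto
  qed
  have sel: "(\<Sum>a\<in>N. v a * (if a = m then 1 else 0)) = v m" if "m \<in> N" for v :: "'a \<Rightarrow> 'k" and m
    using that finite_N by (simp add: if_distrib[of "\<lambda>x. _ * x"] cong: if_cong)
  have sym: "\<Gamma>' i j = \<Gamma>' j i" if "i \<in> N" "j \<in> N" for i j
  proof -
    have "\<Gamma>' i j = (\<Sum>a\<in>N. \<Gamma>' a j * app \<Gamma> N (\<lambda>m. \<Gamma>' m i) a)"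
      using sel[OF that(1), of "\<lambda>a. \<Gamma>' a j"] col[OF that(1)] by simp
    also have "\<dots> = (\<Sum>a\<in>N. \<Gamma>' a i * app \<Gamma> N (\<lambda>m. \<Gamma>' m j) a)" by (rule app_swap)
    also have "\<dots> = \<Gamma>' j i"
      using sel[OF that(2), of "\<lambda>a. \<Gamma>' a i"] col[OF that(2)] by simp
    finally show ?thesis .
  qed
  have inv: "app \<Gamma>' N (app \<Gamma> N w) m = w m" if "m \<in> N" for w m
  proof -
    have "app \<Gamma>' N (app \<Gamma> N w) m = (\<Sum>a\<in>N. \<Gamma>' a m * app \<Gamma> N w a)"
      unfolding app_def by (rule sum.cong) (use sym that in auto)
    also have "\<dots> = (\<Sum>a\<in>N. w a * app \<Gamma> N (\<lambda>b. \<Gamma>' b m) a)" by (rule app_swap)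
    also have "\<dots> = w m" using sel[OF that, of w] col[OF that] by simp
    finally show ?thesis .
  qed
  have scale: "app \<Gamma>' N (\<lambda>m. u m / c) k = app \<Gamma>' N u k / c" for u c k
    by (simp add: app_def sum_divide_distrib)
  have dual: "\<exists>v. is_residual \<Gamma>' j K v \<and> (\<forall>m\<in>N.
      app \<Gamma>' (insert j K) v m = residual \<Gamma> j (N - insert j K) m / pcov \<Gamma> j j (N - insert j K))"
    if K: "K \<subseteq> N" "j \<in> N - K" for j K
  proof -
    let ?C = "N - insert j K"
    let ?w = "residual \<Gamma> j ?C" and ?p = "pcov \<Gamma> j j ?C"
    let ?v = "\<lambda>m. if m \<in> insert j K then app \<Gamma> N ?w m / ?p else 0"
    have C: "?C \<subseteq> N" "j \<in> N - ?C" using K by auto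
    have p: "?p \<noteq> 0" using pcov_nz[OF C] .
    have v: "?v m = app \<Gamma> N ?w m / ?p" if "m \<in> N" for m
      using that pcov_inside[of ?C j m] C pcov_conv_app[OF C, of m] by auto
    have app: "app \<Gamma>' (insert j K) ?v m = ?w m / ?p" if "m \<in> N" for m
    proof -
      have "app \<Gamma>' (insert j K) ?v m = app \<Gamma>' N ?v m"
        by (rule app_mono_neutral) (use K finite_N in auto)
      also have "\<dots> = app \<Gamma>' N (\<lambda>m. app \<Gamma> N ?w m / ?p) m" by (rule app_cong) (use v in auto)
      also have "\<dots> = app \<Gamma>' N (app \<Gamma> N ?w) m / ?p" by (rule scale)
      finally show ?thesis using inv[OF that] by simp
    qed
    have "is_residual \<Gamma>' j K ?v"
      unfolding is_residual_def
    proof (intro conjI ballI)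
      show "?v j = 1" using p pcov_conv_app[OF C, of j] by simp
      show "app \<Gamma>' (insert j K) ?v k = 0" if "k \<in> K" for k
      proof -
        have "k \<in> N" "?w k = 0" using residual_outside[of ?C j k] that K by auto
        then show ?thesis using app[of k] by simp
      qed
    qed auto
    then show ?thesis using app by blast
  qed
  have "minor \<Gamma>' K K > 0" if "K \<subseteq> N" for K
  proof -
    have "finite K" using that by (rule finK)
    then show ?thesis using that
    proof (induction K rule: finite_induct)
      case empty
      show ?case by (simp add: minor_empty)
    next
      case (insert j K)
      then have jK: "K \<subseteq> N" "j \<in> N - K" by auto
      obtain v where v: "is_residual \<Gamma>' j K v" "app \<Gamma>' (insert j K) v j
        = residual \<Gamma> j (N - insert j K) j / pcov \<Gamma> j j (N - insert j K)"
        using dual[OF jK] jK by blast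
      \<comment> \<open>The pivots of the inverse are reciprocals of partial variances of
        \<Gamma>.\<close>
      have "app \<Gamma>' (insert j K) v j > 0"
        unfolding v(2) using pcov_pos[of "N - insert j K" j] jK by auto
      then show ?case
        using minor_insert_residual[OF insert.hyps v(1)] insert.IH jK by simp
    qed
  qed
  then have pp: "principally_positive N \<Gamma>'"
    using sym by (simp add: principally_positive_def symmetric_on_def)
  then interpret D: positive_matrix N \<Gamma>' by unfold_locales (use finite_N in auto)
  have "ci i j K \<in> ci_structure_of N \<Gamma>' \<longleftrightarrow> ci i j (N - insert i (insert j K)) \<in> ci_structure_of N \<Gamma>"
    if K: "K \<subseteq> N" "i \<in> N - K" "j \<in> N - K" "i \<noteq> j" for i j K
  proof -
    let ?C = "N - insert j K" and ?D = "N - insert i (insert j K)"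
    obtain v where v: "is_residual \<Gamma>' j K v" "app \<Gamma>' (insert j K) v i = residual \<Gamma> j ?C i / pcov \<Gamma> j j ?C"
      using dual[of K j] K by blast
    have "pcov \<Gamma>' i j K = residual \<Gamma> j ?C i / pcov \<Gamma> j j ?C"
      using v(2) D.residual_unique[OF K(1,3) v(1)] by (simp add: pcov_def[of \<Gamma>' i j K])
    moreover have "residual \<Gamma> j ?C i = - pcov \<Gamma> i j (?C - {i}) / pcov \<Gamma> i i (?C - {i})"
      by (rule residual_inside) (use K in auto)
    moreover have "?C - {i} = ?D" by blast
    moreover have "pcov \<Gamma> j j ?C \<noteq> 0" "pcov \<Gamma> i i ?D \<noteq> 0" using pcov_nz[of ?C j] pcov_nz[of ?D i] K by auto
    ultimately have "pcov \<Gamma>' i j K = 0 \<longleftrightarrow> pcov \<Gamma> i j ?D = 0" by simp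
    then show ?thesis using ci_mem_iff'[of ?D i j] D.ci_mem_iff'[of K i j] K by auto
  qed
  then show ?thesis using pp by blast
qed

section \<open>Completeness of the gaussoid axioms\<close>

lemma ex_two_disjoint:
  assumes N: "finite N" "i \<in> N" "j \<in> N" "k \<in> N" "l \<in> N" "distinct [i, j, k, l]"
    and K: "K \<subseteq> N - {i, j}" and M: "M \<subseteq> N - {k, l}"
  shows "\<exists>\<Gamma> :: 'a \<Rightarrow> 'a \<Rightarrow> 'k::linordered_field. principally_positive N \<Gamma> \<and>
    ci_structure_of N \<Gamma> = {ci i j K, ci k l M}"
proof -
  have K': "K \<subseteq> N - {j, i}" and M': "M \<subseteq> N - {l, k}" using K M by auto
  consider "i \<notin> M" | "j \<notin> M" | "k \<notin> K" | "l \<notin> K" | "i \<in> M" "j \<in> M" "k \<in> K" "l \<in> K" by blast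
  then show ?thesis
  proof cases
    case 1
    then show ?thesis using ex_two_disjoint_asym[of N i j k l K M] assms by simp
  next
    case 2
    then show ?thesis
      using ex_two_disjoint_asym[of N j i k l K M] assms K' by (auto simp: ci_commute[of i j])
  next
    case 3
    then show ?thesis
      using ex_two_disjoint_asym[of N k l i j M K] assms by (auto simp: insert_commute)
  next
    case 4
    then show ?thesis
      using ex_two_disjoint_asym[of N l k i j M K] assms M'
      by (auto simp: ci_commute[of k l] insert_commute)
  next
    case 5
    define c where "c a b C = N - ({a, b} \<union> C)" for a b C
    have c: "N - insert a (insert b C) = c a b C" for a b C by (simp add: c_def)
    \<comment> \<open>\<open>i \<in> M\<close> means that the complement \<open>c k l M\<close>
      omits \<open>i\<close>, as the asymmetric construction requires.\<close>
    have "c i j K \<subseteq> N - {i, j}" "c k l M \<subseteq> N - {k, l}" "i \<notin> c k l M"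
      using 5 by (auto simp: c_def)
    from ex_two_disjoint_asym[OF N this]
    obtain \<Gamma> :: "'a \<Rightarrow> 'a \<Rightarrow> 'k" where \<Gamma>: "principally_positive N \<Gamma>"
      "ci_structure_of N \<Gamma> = {ci i j (c i j K), ci k l (c k l M)}" by blast
    interpret positive_matrix N \<Gamma> by unfold_locales (use N \<Gamma> in auto)
    obtain \<Gamma>' :: "'a \<Rightarrow> 'a \<Rightarrow> 'k" where \<Gamma>': "principally_positive N \<Gamma>'"
      "\<forall>K\<subseteq>N. \<forall>i\<in>N - K. \<forall>j\<in>N - K. i \<noteq> j \<longrightarrow>
        (ci i j K \<in> ci_structure_of N \<Gamma>' \<longleftrightarrow> ci i j (c i j K) \<in> ci_structure_of N \<Gamma>)"
      using ex_dual[unfolded c] by (elim exE conjE)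
    interpret D: positive_matrix N \<Gamma>' by unfold_locales (use N \<Gamma>' in auto)
    have cc: "c a b (c a b C) = C" if "C \<subseteq> N - {a, b}" for a b C
      using that by (auto simp: c_def)
    have "ci i j K \<in> ci_structure_of N \<Gamma>'"
    proof -
      have "K \<subseteq> N" "i \<in> N - K" "j \<in> N - K" "i \<noteq> j" using N K by auto
      then show ?thesis using \<Gamma>' \<Gamma>(2) by blast
    qed
    moreover have "ci k l M \<in> ci_structure_of N \<Gamma>'"
    proof -
      have "M \<subseteq> N" "k \<in> N - M" "l \<in> N - M" "k \<noteq> l" using N M by auto
      then show ?thesis using \<Gamma>' \<Gamma>(2) by blast
    qed
    moreover have "s \<in> {ci i j K, ci k l M}" if s: "s \<in> ci_structure_of N \<Gamma>'" for s
    proof -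
      obtain a b C where abC: "s = ci a b C" "C \<subseteq> N" "a \<in> N - C" "b \<in> N - C" "a \<noteq> b"
        using D.ci_structureE[OF s] by metis
      have cC: "c a b (c a b C) = C" by (rule cc) (use abC in auto)
      have "ci a b (c a b C) \<in> ci_structure_of N \<Gamma>" using s \<Gamma>'(2) abC by blast
      then have "ci a b (c a b C) = ci i j (c i j K) \<or> ci a b (c a b C) = ci k l (c k l M)"
        using \<Gamma>(2) by simp
      then consider "{a, b} = {i, j}" "c a b C = c i j K" | "{a, b} = {k, l}" "c a b C = c k l M"
        unfolding ci_def prod.inject by blast
      then show ?thesis
      proof cases
        case 1
        then have "c a b = c i j" unfolding c_def by simp
        then have "C = K" using cC cc[OF K] 1(2) by metis
        then show ?thesis using abC 1 by (simp add: ci_def)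
      next
        case 2
        then have "c a b = c k l" unfolding c_def by simp
        then have "C = M" using cC cc[OF M] 2(2) by metis
        then show ?thesis using abC 2 by (simp add: ci_def)
      qed
    qed
    ultimately have "ci_structure_of N \<Gamma>' = {ci i j K, ci k l M}" by blast
    then show ?thesis using \<Gamma>'(1) by blast
  qed
qed

section \<open>Structures between two given statements and a gaussoid\<close>

lemma gaussoid_subset: "gaussoid N G \<Longrightarrow> G \<subseteq> ci_statements N"
  by (simp add: gaussoid_def)

lemma gaussoidD:
  assumes "gaussoid N G" "i \<in> N" "j \<in> N" "k \<in> N" "i \<noteq> j" "i \<noteq> k" "j \<noteq> k" "L \<subseteq> N - {i, j, k}"
  shows "ci i j L \<in> G \<and> ci i k (insert j L) \<in> G \<longleftrightarrow> ci i k L \<in> G \<and> ci i j (insert k L) \<in> G"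
    and "ci i j (insert k L) \<in> G \<and> ci i k (insert j L) \<in> G \<longleftrightarrow> ci i j L \<in> G \<and> ci i k L \<in> G"
    and "ci i j L \<in> G \<Longrightarrow> ci i j (insert k L) \<in> G \<Longrightarrow> ci i k L \<in> G \<or> ci j k L \<in> G"
  using assms unfolding gaussoid_def by metis+

text \<open>Two members of a \<open>quad\<close> imply the rest by the first two axioms unless they
  differ in the conditioning set alone. For that case \<open>third\<close> supplies another member;
  as a hypothesis it leaves open which side of the disjunctive axiom holds.\<close>

lemma gaussoid_quad:
  assumes G: "gaussoid N G" "i \<in> N" "x \<in> N - {i}" "y \<in> N - {i}" "x \<noteq> y" "I \<subseteq> N - {i, x, y}"
    and j: "ci i j K \<in> G" and l: "ci i l M \<in> G" and ne: "(j, K) \<noteq> (l, M)"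
    and sub: "{(j, K), (l, M), (a, C)} \<subseteq> quad x y I"
    and third: "\<And>z J. j = l \<Longrightarrow> z \<notin> J \<Longrightarrow> {K, M} = {J, insert z J} \<Longrightarrow> ci i z J \<in> G"
  shows "ci i a C \<in> G"
proof -
  have ax: "ci i x I \<in> G \<and> ci i y (insert x I) \<in> G \<longleftrightarrow> ci i y I \<in> G \<and> ci i x (insert y I) \<in> G"
    "ci i x (insert y I) \<in> G \<and> ci i y (insert x I) \<in> G \<longleftrightarrow> ci i x I \<in> G \<and> ci i y I \<in> G"
    using gaussoidD(1,2)[OF G(1), of i x y I] G by auto
  have notin: "x \<notin> I" "y \<notin> I" using G by auto
  have jK: "(j, K) \<in> quad x y I" and lM: "(l, M) \<in> quad x y I" and aC: "(a, C) \<in> quad x y I"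
    using sub by auto
  have all: "ci i x I \<in> G \<and> ci i y I \<in> G \<and> ci i x (insert y I) \<in> G \<and> ci i y (insert x I) \<in> G"
  proof (cases "j = l")
    case True
    have "{K, M} = {I, insert y I} \<and> j = x \<or> {K, M} = {I, insert x I} \<and> j = y"
      using True jK lM ne \<open>x \<noteq> y\<close> unfolding quad_def by auto
    then show ?thesis
    proof (elim disjE conjE)
      assume KM: "{K, M} = {I, insert y I}" "j = x"
      then have "ci i y I \<in> G" using third True notin by blast
      moreover have "ci i x I \<in> G" using KM j l True by (auto simp: doubleton_eq_iff)
      ultimately show ?thesis using ax by blast
    next
      assume KM: "{K, M} = {I, insert x I}" "j = y"
      then have "ci i x I \<in> G" using third True notin by blast
      moreover have "ci i y I \<in> G" using KM j l True by (auto simp: doubleton_eq_iff)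
      ultimately show ?thesis using ax by blast
    qed
  next
    case False
    then have "(ci i x I \<in> G \<or> ci i x (insert y I) \<in> G) \<and> (ci i y I \<in> G \<or> ci i y (insert x I) \<in> G)"
      using jK lM j l \<open>x \<noteq> y\<close> unfolding quad_def by auto
    then show ?thesis using ax by blast
  qed
  then show ?thesis using aC unfolding quad_def by auto
qed

lemma ex_between_common:
  assumes N: "finite N" and G: "gaussoid N G" and i: "i \<in> N"
    and j: "j \<in> N - {i}" "K \<subseteq> N - {i, j}" and l: "l \<in> N - {i}" "M \<subseteq> N - {i, l}"
    and mem: "ci i j K \<in> G" "ci i l M \<in> G"
    and third: "\<And>z J. j = l \<Longrightarrow> z \<notin> J \<Longrightarrow> {K, M} = {J, insert z J} \<Longrightarrow> ci i z J \<in> G"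
  shows "\<exists>\<Gamma> :: 'a \<Rightarrow> 'a \<Rightarrow> 'k::linordered_field. principally_positive N \<Gamma> \<and>
    {ci i j K, ci i l M} \<subseteq> ci_structure_of N \<Gamma> \<and> ci_structure_of N \<Gamma> \<subseteq> G"
proof -
  obtain \<Gamma> :: "'a \<Rightarrow> 'a \<Rightarrow> 'k" where \<Gamma>: "principally_positive N \<Gamma>"
    "ci i j K \<in> ci_structure_of N \<Gamma>" "ci i l M \<in> ci_structure_of N \<Gamma>"
    "\<forall>s\<in>ci_structure_of N \<Gamma>. s = ci i j K \<or> s = ci i l M \<or>
      (j, K) \<noteq> (l, M) \<and> (\<exists>x y I a C. x \<in> N - {i} \<and> y \<in> N - {i} \<and> x \<noteq> y \<and> I \<subseteq> N - {i, x, y} \<and>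
        s = ci i a C \<and> {(j, K), (l, M), (a, C)} \<subseteq> quad x y I)"
    using ex_two_common[OF N i j l] by (elim exE conjE)
  have "s \<in> G" if "s \<in> ci_structure_of N \<Gamma>" for s
    using \<Gamma>(4)[rule_format, OF that]
  proof (elim disjE conjE exE)
    fix x y I a C
    assume *: "(j, K) \<noteq> (l, M)" "x \<in> N - {i}" "y \<in> N - {i}" "x \<noteq> y" "I \<subseteq> N - {i, x, y}"
      "s = ci i a C" "{(j, K), (l, M), (a, C)} \<subseteq> quad x y I"
    show "s \<in> G"
      unfolding *(6) by (rule gaussoid_quad[OF G i *(2-5) mem *(1) *(7) third])
  qed (use mem in auto)
  then show ?thesis using \<Gamma>(1-3) by blast
qed

lemma ex_between_common':
  assumes N: "finite N" and G: "gaussoid N G" and i: "i \<in> N"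
    and j: "j \<in> N - {i}" "K \<subseteq> N - {i, j}" and l: "l \<in> N - {i}" "M \<subseteq> N - {i, l}"
    and mem: "ci i j K \<in> G" "ci i l M \<in> G"
  shows "\<exists>\<Gamma> :: 'a \<Rightarrow> 'a \<Rightarrow> 'k::linordered_field. principally_positive N \<Gamma> \<and>
    {ci i j K, ci i l M} \<subseteq> ci_structure_of N \<Gamma> \<and> ci_structure_of N \<Gamma> \<subseteq> G"
proof (cases "\<exists>z J. j = l \<and> z \<notin> J \<and> {K, M} = {J, insert z J}")
  case True
  then obtain z J where zJ: "j = l" "z \<notin> J" "{K, M} = {J, insert z J}" by (elim exE conjE)
  \<comment> \<open>\<open>J\<close> is the intersection of \<open>K\<close> and \<open>M\<close>,
    and \<open>z\<close> the rest of their union, so \<open>third\<close> has a single instance to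
    check.\<close>
  have unique: "z' = z \<and> J' = J" if "z' \<notin> J'" "{K, M} = {J', insert z' J'}" for z' J'
  proof -
    have "J = \<Inter> {K, M}" "insert z J = \<Union> {K, M}" unfolding zJ(3) by auto
    moreover have "J' = \<Inter> {K, M}" "insert z' J' = \<Union> {K, M}" unfolding that(2) by auto
    ultimately show ?thesis using zJ(2) that(1) by (metis insert_ident insert_iff)
  qed
  have "insert z J = \<Union> {K, M}" unfolding zJ(3) by auto
  then have zJN: "insert z J \<subseteq> N - {i, j}" using zJ(1) j l by auto
  then have z: "z \<in> N" "i \<noteq> z" "j \<noteq> z" "J \<subseteq> N - {i, j, z}" using zJ(2) by auto
  have ij: "j \<in> N" "i \<noteq> j" using j by auto
  have "ci i j X \<in> G" if "X \<in> {K, M}" for X using that mem zJ(1) by auto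
  then have "ci i j J \<in> G" "ci i j (insert z J) \<in> G" unfolding zJ(3) by auto
  then have "ci i z J \<in> G \<or> ci j z J \<in> G"
    by (rule gaussoidD(3)[OF G i ij(1) z(1) ij(2) z(2,3,4)])
  then show ?thesis
  proof
    assume third: "ci i z J \<in> G"
    show ?thesis
      by (rule ex_between_common[OF N G i j l mem]) (use unique third in metis)
  next
    assume third: "ci j z J \<in> G"
    \<comment> \<open>Since \<open>j = l\<close>, both statements concern the same pair, and
      \<open>i\<close> and \<open>j\<close> can trade places so that row \<open>j\<close> is added
      last.\<close>
    have *: "j \<in> N" "i \<in> N - {j}" "K \<subseteq> N - {j, i}" "M \<subseteq> N - {j, i}" "ci j i K \<in> G" "ci j i M \<in> G"
      using i j l mem zJ(1) by (auto simp: ci_commute[of l i])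
    have "\<exists>\<Gamma> :: 'a \<Rightarrow> 'a \<Rightarrow> 'k. principally_positive N \<Gamma> \<and>
      {ci j i K, ci j i M} \<subseteq> ci_structure_of N \<Gamma> \<and> ci_structure_of N \<Gamma> \<subseteq> G"
      by (rule ex_between_common[OF N G *(1,2,3,2,4,5,6)]) (use unique third in metis)
    then show ?thesis by (simp only: zJ(1)[symmetric] ci_commute[of i j])
  qed
next
  case False
  show ?thesis
  proof (rule ex_between_common[OF N G i j l mem])
    fix z J assume "j = l" "z \<notin> J" "{K, M} = {J, insert z J}"
    then have "\<exists>z J. j = l \<and> z \<notin> J \<and> {K, M} = {J, insert z J}" by (intro exI conjI)
    with False show "ci i z J \<in> G" by (rule notE)
  qed
qed

text \<open>Pairs that meet, including equal ones, can be written with a common first index.\<close>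

lemma ex_between_pair:
  assumes N: "finite N" and G: "gaussoid N G" and s: "s \<in> G" and t: "t \<in> G"
  shows "\<exists>\<Gamma> :: 'a \<Rightarrow> 'a \<Rightarrow> 'k::linordered_field. principally_positive N \<Gamma> \<and>
    {s, t} \<subseteq> ci_structure_of N \<Gamma> \<and> ci_structure_of N \<Gamma> \<subseteq> G"
proof -
  obtain i j K where ijK: "s = ci i j K" "i \<in> N" "j \<in> N" "i \<noteq> j" "K \<subseteq> N - {i, j}"
    using s gaussoid_subset[OF G] unfolding ci_statements_def by blast
  obtain k l M where klM: "t = ci k l M" "k \<in> N" "l \<in> N" "k \<noteq> l" "M \<subseteq> N - {k, l}"
    using t gaussoid_subset[OF G] unfolding ci_statements_def by blast
  show ?thesis
  proof (cases "distinct [i, j, k, l]")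
    case True
    then show ?thesis using ex_two_disjoint[OF N ijK(2,3) klM(2,3) True ijK(5) klM(5)] s t ijK klM
      by (metis insert_subset subset_refl empty_subsetI)
  next
    case False
    then obtain a b c where "s = ci a b K" "a \<in> N" "b \<in> N - {a}" "K \<subseteq> N - {a, b}"
      "t = ci a c M" "c \<in> N - {a}" "M \<subseteq> N - {a, c}"
    proof -
      have sw: "s = ci j i K" "K \<subseteq> N - {j, i}" "t = ci l k M" "M \<subseteq> N - {l, k}"
        using ijK klM by (auto simp: ci_commute)
      consider "i = k" | "i = l" | "j = k" | "j = l" using False ijK klM by auto
      then show thesis
        by cases (rule that[of i j l] that[of i j k] that[of j i l] that[of j i k];
            use ijK klM sw in simp; fail)+
    qed
    then show ?thesis using ex_between_common'[OF N G] s t by metis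
  qed
qed

lemma ex_between:
  assumes N: "finite N" and G: "gaussoid N G" and L: "L \<subseteq> G" "card L \<le> 2"
  shows "\<exists>\<Gamma> :: 'a \<Rightarrow> 'a \<Rightarrow> 'k::linordered_field. principally_positive N \<Gamma> \<and>
    L \<subseteq> ci_structure_of N \<Gamma> \<and> ci_structure_of N \<Gamma> \<subseteq> G"
proof -
  \<comment> \<open>Infinite sets have \<open>card\<close> 0, so finiteness of \<open>L\<close> must
    precede the use of its bound. Below, \<open>s = t\<close> covers singletons.\<close>
  have "ci_statements N \<subseteq> Pow N \<times> Pow N" unfolding ci_statements_def ci_def by auto
  then have "finite L"
    using L(1) gaussoid_subset[OF G] N by (meson finite_Pow_iff finite_SigmaI finite_subset)
  then consider "L = {}" | s t where "L = {s, t}"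
    using L(2) by (metis card_1_singletonE card_2_iff card_eq_0_iff insert_absorb2 le_Suc_eq
        le_zero_eq numeral_2_eq_2 One_nat_def)
  then show ?thesis
  proof cases
    case 1
    obtain \<Gamma> :: "'a \<Rightarrow> 'a \<Rightarrow> 'k" where "generic_matrix N \<Gamma>" using ex_generic[OF N] by blast
    then interpret generic_matrix N \<Gamma> .
    show ?thesis using 1 pos empty by blast
  next
    case 2
    then show ?thesis using ex_between_pair[OF N G, of s t] L(1) by simp
  qed
qed

section \<open>Transfer of rational matrices to other fields\<close>

lemma minor_of_rat:
  "minor (\<lambda>i j. of_rat (\<Gamma> i j) :: 'k::field_char_0) I J = of_rat (minor \<Gamma> I J)"
proof -
  have "submat (\<lambda>i j. of_rat (\<Gamma> i j) :: 'k) rs cs = map_mat of_rat (submat \<Gamma> rs cs)" for rs cs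
    by (rule eq_matI) (auto simp: submat_def)
  then show ?thesis by (simp add: minor_def of_rat_hom.hom_det)
qed

lemma ci_structure_of_rat:
  "ci_structure_of N (\<lambda>i j. of_rat (\<Gamma> i j) :: 'k::field_char_0) = ci_structure_of N \<Gamma>"
  by (simp add: ci_structure_of_def minor_of_rat)

lemma principally_positive_of_rat:
  assumes "principally_positive N \<Gamma>"
  shows "principally_positive N (\<lambda>i j. of_rat (\<Gamma> i j) :: 'k::linordered_field)"
  using assms by (simp add: principally_positive_def symmetric_on_def minor_of_rat)

lemma principally_regular_of_rat:
  assumes "principally_positive N \<Gamma>"
  shows "principally_regular N (\<lambda>i j. of_rat (\<Gamma> i j) :: 'k::field_char_0)"
  using assms
  by (auto simp: principally_positive_def principally_regular_def symmetric_on_def minor_of_rat)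

text \<open>The realized structure contains \<open>L\<close>, hence meets \<open>M\<close>, and it
  lies inside the gaussoid. Both parts of the theorem share this argument through rational
  matrices.\<close>

lemma antecedental_approximationI:
  assumes N: "finite N" and sub: "\<And>A. A \<in> \<AA> \<Longrightarrow> gaussoid N A"
    and real: "\<And>\<Gamma> :: 'a \<Rightarrow> 'a \<Rightarrow> rat. principally_positive N \<Gamma> \<Longrightarrow> ci_structure_of N \<Gamma> \<in> \<AA>"
  shows "antecedental_approximation 2 N {G. gaussoid N G} \<AA>"
  unfolding antecedental_approximation_def
proof (intro conjI allI impI)
  fix L M
  assume *: "L \<subseteq> ci_statements N \<and> M \<subseteq> ci_statements N \<and> card L \<le> 2 \<and> valid_inference \<AA> L M"
  have "G \<inter> M \<noteq> {}" if G: "gaussoid N G" "L \<subseteq> G" for G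
  proof -
    obtain \<Gamma> :: "'a \<Rightarrow> 'a \<Rightarrow> rat" where \<Gamma>: "principally_positive N \<Gamma>"
      "L \<subseteq> ci_structure_of N \<Gamma>" "ci_structure_of N \<Gamma> \<subseteq> G"
      using ex_between[OF N G] * by blast
    have "ci_structure_of N \<Gamma> \<inter> M \<noteq> {}"
      using * real[OF \<Gamma>(1)] \<Gamma>(2) unfolding valid_inference_def satisfies_inference_def by blast
    then show ?thesis using \<Gamma>(3) by blast
  qed
  then show "valid_inference {G. gaussoid N G} L M"
    unfolding valid_inference_def satisfies_inference_def by blast
qed (use sub gaussoid_subset in auto)

theorem corollary3p4:
  fixes N :: "'a set"
  assumes "finite N"
  shows
    "antecedental_approximation 2 N {G. gaussoid N G}
        {A. algebraically_realizable TYPE('k::field_char_0) N A} \<and>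
     antecedental_approximation 2 N {G. gaussoid N G}
        {A. positively_realizable TYPE('r::linordered_field) N A}"
proof (intro conjI antecedental_approximationI[OF assms])
  fix A
  assume "A \<in> {A. algebraically_realizable TYPE('k) N A}"
  then obtain \<Gamma> :: "'a \<Rightarrow> 'a \<Rightarrow> 'k" where \<Gamma>: "principally_regular N \<Gamma>" "A = ci_structure_of N \<Gamma>"
    by (auto simp: algebraically_realizable_def)
  interpret regular_matrix N \<Gamma> by unfold_locales (use assms \<Gamma> in auto)
  show "gaussoid N A" unfolding \<Gamma>(2) by (rule gaussoid)
next
  fix A
  assume "A \<in> {A. positively_realizable TYPE('r) N A}"
  then obtain \<Gamma> :: "'a \<Rightarrow> 'a \<Rightarrow> 'r" where \<Gamma>: "principally_positive N \<Gamma>" "A = ci_structure_of N \<Gamma>"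
    by (auto simp: positively_realizable_def)
  interpret positive_matrix N \<Gamma> by unfold_locales (use assms \<Gamma> in auto)
  show "gaussoid N A" unfolding \<Gamma>(2) by (rule gaussoid)
next
  fix \<Gamma> :: "'a \<Rightarrow> 'a \<Rightarrow> rat"
  assume \<Gamma>: "principally_positive N \<Gamma>"
  show "ci_structure_of N \<Gamma> \<in> {A. algebraically_realizable TYPE('k) N A}"
    unfolding algebraically_realizable_def
    using principally_regular_of_rat[OF \<Gamma>, where 'k = 'k] ci_structure_of_rat[of N \<Gamma>, where 'k = 'k] by blast
  show "ci_structure_of N \<Gamma> \<in> {A. positively_realizable TYPE('r) N A}"
    unfolding positively_realizable_def
    using principally_positive_of_rat[OF \<Gamma>, where 'k = 'r] ci_structure_of_rat[of N \<Gamma>, where 'k = 'r] by blast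
qed

end
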